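(* Solutions of all linear second order ordinary differential equations $u''(z)+h(z)u(z)=0$, with any $h$ holomorphic on an open set $\mathcal{U}\subset\mathbb{C}$, can be locally expressed through geodesic curves in the two-dimensional geometry of a complex sphere with imaginary unit radius. More precisely: Let $h$ be holomorphic on $\mathcal{U}$, let $\mathcal{U}_0\subset\mathcal{U}$ be open, let $z_0\in\mathcal{U}_0$, let $X:\mathcal{U}_0\to\mathbb{C}\setminus\{0\}$ be holomorphic on $\mathcal{U}_0$, and let $h(z)\neq X^2(z)$ on $\mathcal{U}_0$. Let $\gamma_z$ be an arbitrary holomorphic curve in $\mathcal{U}_0$ which starts at $z_0$ and ends at $z$. If $[h(z)-X^2(z)]^2+[X'(z)]^2\not\equiv0$ on $\mathcal{U}_0$ and $$u_{\mathtt{top}}(z)=\exp\left[\int_{\gamma_z}d\zeta\,X(\zeta)\,\frac{X'(\zeta)-\sqrt{[h(\zeta)-X^2(\zeta)]^2+[X'(\zeta)]^2}}{h(\zeta)-X^2(\zeta)}\right],$$ $$u_{\mathtt{bot}}(z)=\exp\left[\int_{\gamma_z}d\zeta\,X(\zeta)\,\frac{X'(\zeta)+\sqrt{[h(\zeta)-X^2(\zeta)]^2+[X'(\zeta)]^2}}{h(\zeta)-X^2(\zeta)}\right],$$ then, for two arbitrary constants $A$ and $B$, $$u(z)=A\,u_{\mathtt{top}}(z)+B\,u_{\mathtt{bot}}(z)$$ is a general solution of $u''(z)+h(z)u(z)=0$ on $\mathcal{U}_0$ if and only if $X$ is a solution on $\mathcal{U}_0$ of $$X''(z)=\frac{3X^{2}(z)+h(z)}{X^{2}(z)-h(z)}\,\frac{[X'(z)]^{2}}{X(z)}-\frac{h'(z)X'(z)}{X^{2}(z)-h(z)}+\frac{X^{4}(z)-h^{2}(z)}{X(z)}.$$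 The functions $u_{\mathtt{top}}$ and $u_{\mathtt{bot}}$ do not depend on the shape of the curve $\gamma_z$.
   Context: The displayed second order equation for $X$ is the equation of geodesic curves in explicit form on the complex Riemannian manifold $\mathbb{M}_h^{\mathbb C}=(\mathcal{H}_{\mathbb C},G_h)$, where $\mathcal{H}_{\mathbb C}=\{(z,\mathfrak{X})\in\mathcal{U}\times(\mathbb{C}\setminus\{0\}):\mathfrak{X}^2\neq h(z)\}$ and $G_h=\mathfrak{X}^{-2}\left[(h(z)-\mathfrak{X}^2)^2dz^2+d\mathfrak{X}^2\right]$, which is locally holomorphically isometric to the complex $2$-sphere $(Z^1)^2+(Z^2)^2+(Z^3)^2=i^2$ in $\mathbb{C}^3$. Here "explicit form" means: for a complex geodesic $\upsilon\mapsto(z(\upsilon),\mathfrak{X}(\upsilon))$ with complex affine parameter $\upsilon$, and open sets $\mathcal{V}_0\subset\mathbb{C}$, $\mathcal{U}_0\subset\mathcal{U}$ with $0\in\mathcal{V}_0$, $z_0=z(0)\in\mathcal{U}_0$, such that the map $\mathcal{V}_0\ni\upsilon\mapsto z(\upsilon)\in\mathcal{U}_0$ has $\dot z(\upsilon)\neq0$, one writes $\mathfrak{X}(\upsilon)=X(z(\upsilon))$. Holomorphic curves $\gamma_z$ in $\mathcal{U}_0$ are constructed as images $[0,1]\ni s\mapsto\zeta(\upsilon(s))\in\mathcal{U}_0$ of a path $s\mapsto\upsilon(s)\in\mathcal{V}_0$ under a holomorphic function $\zeta(\upsilon)$, with $\upsilon(0)=0$, $\upsilon(1)=1$ (after rescaling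 $\upsilon$), $\zeta(0)=z_0$ and $\zeta(1)=z$.
   Formalization: The open set U_0 is assumed simply connected (otherwise u_top and u_bot can depend on the curve, e.g. h=ab/z^2, a+b=1, X=sqrt(-ab)/z on a punctured plane), and the square root is read as a continuous branch on U_0, any branch being allowed. *)

theory Defs
  imports "HOL-Complex_Analysis.Complex_Analysis"
begin

text \<open>Holomorphic Riemannian metrics on open subsets of \<open>\<complex>\<^sup>n\<close>: complex partial derivatives,
  Christoffel symbols of the Levi-Civita connection, and geodesics with a complex affine
  parameter.\<close>

definition complex_partial :: "'n::finite \<Rightarrow> (complex^'n \<Rightarrow> complex) \<Rightarrow> complex^'n \<Rightarrow> complex" where
  "complex_partial i f p = deriv (\<lambda>t. f (p + axis i t)) 0"

definition christoffel ::
    "(complex^'n::finite \<Rightarrow> complex^'n^'n) \<Rightarrow> 'n \<Rightarrow> 'n \<Rightarrow> 'n \<Rightarrow> complex^'n \<Rightarrow> complex" where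
  "christoffel G k i j p = (1/2) * (\<Sum>l\<in>UNIV. matrix_inv (G p) $ k $ l *
     (complex_partial i (\<lambda>q. G q $ j $ l) p + complex_partial j (\<lambda>q. G q $ i $ l) p
      - complex_partial l (\<lambda>q. G q $ i $ j) p))"

definition complex_geodesic ::
    "(complex^'n::finite) set \<Rightarrow> (complex^'n \<Rightarrow> complex^'n^'n) \<Rightarrow> complex set \<Rightarrow>
     (complex \<Rightarrow> complex^'n) \<Rightarrow> bool" where
  "complex_geodesic M G V c \<longleftrightarrow>
     open V \<and> c ` V \<subseteq> M \<and> (\<forall>k. (\<lambda>v. c v $ k) holomorphic_on V) \<and>
     (\<forall>v\<in>V. \<forall>k. deriv (deriv (\<lambda>w. c w $ k)) v
        + (\<Sum>i\<in>UNIV. \<Sum>j\<in>UNIV. christoffel G k i j (c v)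
             * deriv (\<lambda>w. c w $ i) v * deriv (\<lambda>w. c w $ j) v) = 0)"

text \<open>The manifold \<open>(\<H>, G\<^sub>h)\<close> in the coordinates \<open>(z, x)\<close>, with
  \<open>G\<^sub>h = x\<^sup>-\<^sup>2 ((h(z) - x\<^sup>2)\<^sup>2 dz\<^sup>2 + dx\<^sup>2)\<close>. It is locally isometric to the complex sphere of radius
  \<open>\<i>\<close>.\<close>

definition Hmfd :: "(complex \<Rightarrow> complex) \<Rightarrow> complex set \<Rightarrow> (complex^2) set" where
  "Hmfd h U = {p. p $ 1 \<in> U \<and> p $ 2 \<noteq> 0 \<and> (p $ 2)\<^sup>2 \<noteq> h (p $ 1)}"

definition Gmetric :: "(complex \<Rightarrow> complex) \<Rightarrow> complex^2 \<Rightarrow> complex^2^2" where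
  "Gmetric h p = vector [vector [(h (p $ 1) - (p $ 2)\<^sup>2)\<^sup>2 / (p $ 2)\<^sup>2, 0],
                         vector [0, 1 / (p $ 2)\<^sup>2]]"

text \<open>\<open>X\<close> is the explicit form \<open>x(v) = X(z(v))\<close> of a geodesic through \<open>z\<^sub>0\<close> whose
  \<open>z\<close>-component has nonvanishing velocity and sweeps out \<open>U0\<close>.\<close>

definition explicit_geodesic ::
    "(complex \<Rightarrow> complex) \<Rightarrow> complex set \<Rightarrow> complex set \<Rightarrow> complex \<Rightarrow> (complex \<Rightarrow> complex) \<Rightarrow> bool" where
  "explicit_geodesic h U U0 z0 X \<longleftrightarrow>
     (\<exists>V0 c. 0 \<in> V0 \<and> complex_geodesic (Hmfd h U) (Gmetric h) V0 c \<and>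
        c 0 $ 1 = z0 \<and> (\<lambda>v. c v $ 1) ` V0 = U0 \<and>
        (\<forall>v\<in>V0. deriv (\<lambda>w. c w $ 1) v \<noteq> 0 \<and> c v $ 2 = X (c v $ 1)))"

definition geodesic_ode ::
    "(complex \<Rightarrow> complex) \<Rightarrow> complex set \<Rightarrow> (complex \<Rightarrow> complex) \<Rightarrow> bool" where
  "geodesic_ode h U0 X \<longleftrightarrow> (\<forall>z\<in>U0. deriv (deriv X) z =
      (3 * (X z)\<^sup>2 + h z) / ((X z)\<^sup>2 - h z) * ((deriv X z)\<^sup>2 / X z)
      - deriv h z * deriv X z / ((X z)\<^sup>2 - h z)
      + ((X z)^4 - (h z)\<^sup>2) / X z)"

definition discr :: "(complex \<Rightarrow> complex) \<Rightarrow> (complex \<Rightarrow> complex) \<Rightarrow> complex \<Rightarrow> complex" where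
  "discr h X z = (h z - (X z)\<^sup>2)\<^sup>2 + (deriv X z)\<^sup>2"

text \<open>The square root in the integrands is a single-valued continuous branch; the discontinuous
  principal value \<^const>\<open>csqrt\<close> would make the integrals depend on the curve.\<close>

definition sqrt_branch :: "complex set \<Rightarrow> (complex \<Rightarrow> complex) \<Rightarrow> (complex \<Rightarrow> complex) \<Rightarrow> bool" where
  "sqrt_branch U0 D s \<longleftrightarrow> continuous_on U0 s \<and> (\<forall>z\<in>U0. (s z)\<^sup>2 = D z)"

definition holomorphic_curve ::
    "complex set \<Rightarrow> complex \<Rightarrow> complex \<Rightarrow> (real \<Rightarrow> complex) \<Rightarrow> bool" where
  "holomorphic_curve U0 z0 z g \<longleftrightarrow>
     (\<exists>V0 \<zeta> v. open V0 \<and> \<zeta> holomorphic_on V0 \<and> \<zeta> ` V0 \<subseteq> U0 \<and>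
        valid_path v \<and> path_image v \<subseteq> V0 \<and> pathstart v = 0 \<and> pathfinish v = 1 \<and>
        \<zeta> 0 = z0 \<and> \<zeta> 1 = z \<and> g = \<zeta> \<circ> v)"

text \<open>\<open>s\<close> is the chosen branch of the square root and \<open>g\<close> the curve of integration.\<close>

definition u_top ::
    "(complex \<Rightarrow> complex) \<Rightarrow> (complex \<Rightarrow> complex) \<Rightarrow> (complex \<Rightarrow> complex) \<Rightarrow> (real \<Rightarrow> complex) \<Rightarrow> complex" where
  "u_top h X s g = exp (contour_integral g
     (\<lambda>\<zeta>. X \<zeta> * ((deriv X \<zeta> - s \<zeta>) / (h \<zeta> - (X \<zeta>)\<^sup>2))))"

definition u_bot ::
    "(complex \<Rightarrow> complex) \<Rightarrow> (complex \<Rightarrow> complex) \<Rightarrow> (complex \<Rightarrow> complex) \<Rightarrow> (real \<Rightarrow> complex) \<Rightarrow> complex" where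
  "u_bot h X s g = exp (contour_integral g
     (\<lambda>\<zeta>. X \<zeta> * ((deriv X \<zeta> + s \<zeta>) / (h \<zeta> - (X \<zeta>)\<^sup>2))))"

definition ode_solution :: "(complex \<Rightarrow> complex) \<Rightarrow> complex set \<Rightarrow> (complex \<Rightarrow> complex) \<Rightarrow> bool" where
  "ode_solution h U0 u \<longleftrightarrow>
     u holomorphic_on U0 \<and> (\<forall>z\<in>U0. deriv (deriv u) z + h z * u z = 0)"

definition general_solution ::
    "(complex \<Rightarrow> complex) \<Rightarrow> complex set \<Rightarrow> (complex \<Rightarrow> complex) \<Rightarrow> (complex \<Rightarrow> complex) \<Rightarrow> bool" where
  "general_solution h U0 u1 u2 \<longleftrightarrow>
     (\<forall>A B. ode_solution h U0 (\<lambda>z. A * u1 z + B * u2 z)) \<and>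
     (\<forall>u. ode_solution h U0 u \<longrightarrow> (\<exists>A B. \<forall>z\<in>U0. u z = A * u1 z + B * u2 z))"

end

theory Submission
  imports Defs
begin

text \<open>
  Put \<open>w = h - X\<^sup>2\<close>. The two integrands \<open>f\<close> are the roots of \<open>f\<^sup>2 - p f - X\<^sup>2 = 0\<close> with
  \<open>p = 2 X X' / w\<close>, and \<open>exp (\<integral> f)\<close> solves the linear equation iff \<open>f\<close> satisfies the Riccati equation
  \<open>f' + f\<^sup>2 + h = 0\<close>. Differentiating the product \<open>- X\<^sup>2\<close> of the roots shows that the residuals
  \<open>E\<^sub>1, E\<^sub>2\<close> of the two Riccati equations always satisfy \<open>E\<^sub>1 f\<^sub>2 + E\<^sub>2 f\<^sub>1 = 0\<close>, while \<open>E\<^sub>1 + E\<^sub>2 = 0\<close> is the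
  geodesic equation. Under the geodesic equation \<open>\<delta> = p\<^sup>2 + 4 X\<^sup>2\<close>, which is the discriminant up to the
  factor \<open>4 X\<^sup>2 / w\<^sup>2\<close>, satisfies \<open>\<delta>' = - 2 p \<delta>\<close>; so it vanishes nowhere, has a holomorphic square root,
  and \<open>f\<^sub>1 \<noteq> f\<^sub>2\<close> everywhere, which forces \<open>E\<^sub>1 = E\<^sub>2 = 0\<close> and makes the Wronskian nonzero.
  Conversely, two power series solutions \<open>u\<^sub>1, u\<^sub>2\<close> of the linear equation near a point give
  \<open>X\<^sup>2 = - (u\<^sub>1' / u\<^sub>1) (u\<^sub>2' / u\<^sub>2)\<close>, and integrating the first geodesic equation
  \<open>z'' + K(z) z'\<^sup>2 = 0\<close> recovers the affine parameter.
\<close>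

subsection \<open>The linear equation\<close>

text \<open>Taylor coefficients of the solution with value \<open>a\<close> and derivative
  \<open>b\<close> at the centre, where \<open>H\<close> lists the coefficients of \<open>h\<close>.
  The recursion compares the coefficients of degree \<open>n\<close> in u'' = - h u.\<close>

fun ode_coeff :: "(nat \<Rightarrow> complex) \<Rightarrow> complex \<Rightarrow> complex \<Rightarrow> nat \<Rightarrow> complex" where
  "ode_coeff H a b 0 = a"
| "ode_coeff H a b (Suc 0) = b"
| "ode_coeff H a b (Suc (Suc n)) =
     - (\<Sum>k\<le>n. H k * ode_coeff H a b (n - k)) / (of_nat (n + 1) * of_nat (n + 2))"

text \<open>The \<open>m + 1\<close> summands of the convolution are cancelled by the factor
  \<open>m + 1\<close> of the denominator. What remains is at most \<open>M * R ^ m\<close> times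
  the constant, and \<open>M \<le> R^2\<close> raises the exponent by two without enlarging the
  constant.\<close>

lemma norm_ode_coeff_le:
  assumes H: "\<And>k. norm (H k) \<le> M * R ^ k" and "M \<ge> 0" "R \<ge> 1" "M \<le> R\<^sup>2"
  shows "norm (ode_coeff H a b n) \<le> (norm a + norm b) * R ^ n"
proof (induction n rule: less_induct)
  case (less n)
  consider "n = 0" | "n = Suc 0" | m where "n = Suc (Suc m)"
    by (metis not0_implies_Suc)
  then show ?case
  proof cases
    case 2
    have "norm b \<le> (norm a + norm b) * 1" by simp
    also have "\<dots> \<le> (norm a + norm b) * R"
      using \<open>R \<ge> 1\<close> by (intro mult_left_mono) auto
    finally show ?thesis using 2 by simp
  next
    case (3 m)
    let ?A = "norm a + norm b"
    have "norm (\<Sum>k\<le>m. H k * ode_coeff H a b (m - k)) \<le> (\<Sum>k\<le>m. M * R ^ k * (?A * R ^ (m - k)))"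
    proof (rule sum_norm_le)
      fix k assume "k \<in> {..m}"
      show "norm (H k * ode_coeff H a b (m - k)) \<le> M * R ^ k * (?A * R ^ (m - k))"
        unfolding norm_mult using less[of "m - k"] H[of k] assms 3
        by (intro mult_mono) auto
    qed
    also have "\<dots> = (\<Sum>k\<le>m. M * ?A * R ^ m)"
      by (intro sum.cong) (auto simp: power_add[symmetric] algebra_simps)
    also have "\<dots> = real (m + 1) * (M * ?A * R ^ m)" by simp
    finally have 1: "norm (\<Sum>k\<le>m. H k * ode_coeff H a b (m - k)) \<le> real (m + 1) * (M * ?A * R ^ m)" .
    have "norm (ode_coeff H a b n)
        = norm (\<Sum>k\<le>m. H k * ode_coeff H a b (m - k)) / (real (m + 1) * real (m + 2))"
      unfolding 3 ode_coeff.simps norm_divide norm_minus_cancel norm_mult norm_of_nat ..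
    also have "\<dots> \<le> real (m + 1) * (M * ?A * R ^ m) / (real (m + 1) * real (m + 2))"
      by (intro divide_right_mono 1) auto
    also have "\<dots> = M * ?A * R ^ m / real (m + 2)" by (simp add: divide_simps)
    also have "\<dots> \<le> M * ?A * R ^ m / 1"
      using assms by (intro divide_left_mono mult_nonneg_nonneg) auto
    also have "\<dots> \<le> R\<^sup>2 * ?A * R ^ m / 1"
      using assms by (intro divide_right_mono mult_right_mono) auto
    also have "\<dots> = ?A * R ^ n" by (simp add: 3 power2_eq_square)
    finally show ?thesis .
  qed simp
qed

text \<open>The terms of a power series that converges at some \<open>r > 0\<close> are
  bounded.\<close>

lemma fps_nth_geometric_bound:
  fixes H :: "complex fps"
  assumes "fps_conv_radius H > 0"
  obtains M R where "M \<ge> 0" "R \<ge> 1" "M \<le> R\<^sup>2" "\<And>k. norm (fps_nth H k) \<le> M * R ^ k"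
proof -
  obtain r :: real where r: "r > 0" "ereal r < fps_conv_radius H"
    using assms ereal_dense2[of 0] by auto
  have "summable (\<lambda>n. fps_nth H n * of_real r ^ n)"
    using r by (intro summable_fps) auto
  then have "bounded (range (\<lambda>n. fps_nth H n * of_real r ^ n))"
    using summable_LIMSEQ_zero convergent_imp_bounded by blast
  then obtain M where M: "\<And>n. norm (fps_nth H n * of_real r ^ n) \<le> M"
    by (auto simp: bounded_iff)
  have "M \<ge> 0" using order.trans[OF norm_ge_zero M] .
  \<comment> \<open>The summands secure \<open>R \<ge> 1\<close>, \<open>M \<le> R\<close> (hence
    \<open>M \<le> R^2\<close>) and \<open>1 / r \<le> R\<close> at once.\<close>
  define R where "R = 1 + M + 1 / r"
  have R: "R \<ge> 1" "1 / r \<le> R" "M \<le> R" using \<open>M \<ge> 0\<close> r by (auto simp: R_def)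
  show thesis
  proof
    have "R * 1 \<le> R * R" using R(1) by (intro mult_left_mono) auto
    then show "M \<le> R\<^sup>2" using R(3) by (simp add: power2_eq_square)
    fix k
    have "norm (fps_nth H k) = norm (fps_nth H k * of_real r ^ k) * (1 / r) ^ k"
      using r by (simp add: norm_mult norm_power power_one_over)
    also have "\<dots> \<le> M * R ^ k"
      using M[of k] R r \<open>M \<ge> 0\<close> by (intro mult_mono power_mono) auto
    finally show "norm (fps_nth H k) \<le> M * R ^ k" .
  qed fact+
qed

text \<open>At modulus \<open>1 / (2 * R)\<close> the terms are dominated by a geometric series of
  ratio 1/2.\<close>

lemma fps_conv_radius_pos_if_geometric:
  fixes F :: "complex fps"
  assumes "\<And>n. norm (fps_nth F n) \<le> A * R ^ n" "R \<ge> 1"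
  shows "fps_conv_radius F > 0"
proof -
  let ?z = "of_real (1 / (2 * R)) :: complex"
  have "summable (\<lambda>n. fps_nth F n * ?z ^ n)"
  proof (rule summable_comparison_test)
    show "\<exists>N. \<forall>n\<ge>N. norm (fps_nth F n * ?z ^ n) \<le> A * (1 / 2) ^ n"
    proof (intro exI allI impI)
      fix n
      have "norm (fps_nth F n * ?z ^ n) = norm (fps_nth F n) * (1 / (2 * R)) ^ n"
        using assms(2) by (simp add: norm_mult norm_power norm_divide)
      also have "\<dots> \<le> A * R ^ n * (1 / (2 * R)) ^ n"
        using assms by (intro mult_right_mono) auto
      also have "\<dots> = A * (1 / 2) ^ n"
        using assms(2) by (simp add: power_mult_distrib power_divide)
      finally show "norm (fps_nth F n * ?z ^ n) \<le> A * (1 / 2) ^ n" .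
    qed
    show "summable (\<lambda>n. A * (1 / 2) ^ n :: real)" by (intro summable_mult summable_geometric) auto
  qed
  then have "conv_radius (fps_nth F) \<ge> norm ?z" by (rule conv_radius_geI)
  moreover have "ereal (norm ?z) > 0" using assms(2) by auto
  ultimately show ?thesis unfolding fps_conv_radius_def by (metis less_le_trans)
qed

text \<open>After translating \<open>z0\<close> to 0, the recursion for \<open>ode_coeff\<close> is
  the formal identity F'' + H F = 0. The coefficient bound makes \<open>F\<close> converge, and its
  sum is the solution.\<close>

lemma ode_solution_local:
  assumes "open U" "h holomorphic_on U" "z0 \<in> U"
  obtains r u where "r > 0" "ball z0 r \<subseteq> U" "ode_solution h (ball z0 r) u"
    "u z0 = a" "deriv u z0 = b"
proof -
  define h0 where "h0 w = h (z0 + w)" for w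
  have "h0 holomorphic_on (+) z0 -` U" unfolding h0_def
    by (rule holomorphic_on_compose[of "\<lambda>w. z0 + w" _ h, unfolded o_def])
       (auto intro!: holomorphic_intros holomorphic_on_subset[OF assms(2)])
  moreover have "open ((+) z0 -` U)" using assms(1) by (intro continuous_open_vimage continuous_intros)
  ultimately have h0: "h0 has_fps_expansion fps_expansion h0 0"
    using assms(3) by (intro has_fps_expansion_fps_expansion) auto
  define H where "H = fps_expansion h0 0"
  have "fps_conv_radius H > 0" using h0 by (simp add: has_fps_expansion_def H_def)
  then obtain M R where MR: "M \<ge> 0" "R \<ge> 1" "M \<le> R\<^sup>2" "\<And>k. norm (fps_nth H k) \<le> M * R ^ k"
    using fps_nth_geometric_bound by blast
  define F where "F = Abs_fps (ode_coeff (fps_nth H) a b)"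
  have rad: "fps_conv_radius F > 0"
    by (rule fps_conv_radius_pos_if_geometric[of _ "norm a + norm b" R])
       (use norm_ode_coeff_le[OF MR(4,1,2,3)] MR in \<open>auto simp: F_def\<close>)
  have "fps_deriv (fps_deriv F) + H * F = 0"
  proof (rule fps_ext)
    fix n
    have "of_nat (n + 1) * (of_nat (n + 2) * fps_nth F (n + 2)) = - (\<Sum>k\<le>n. fps_nth H k * fps_nth F (n - k))"
      by (simp add: F_def del: of_nat_Suc of_nat_add)
    then show "fps_nth (fps_deriv (fps_deriv F) + H * F) n = fps_nth 0 n"
      by (simp add: fps_mult_nth atLeast0AtMost del: of_nat_Suc of_nat_add)
  qed
  moreover define v where "v = eval_fps F"
  have v: "v has_fps_expansion F" unfolding v_def using rad by (rule eval_fps_has_fps_expansion)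
  ultimately have "(\<lambda>w. deriv (deriv v) w + h0 w * v w) has_fps_expansion 0"
    using has_fps_expansion_add[OF has_fps_expansion_deriv[OF has_fps_expansion_deriv[OF v]]
        has_fps_expansion_mult[OF h0 v]] by (simp add: H_def)
  \<comment> \<open>A function with expansion 0 vanishes near 0, so the formal identity becomes a
    genuine differential equation.\<close>
  then have "eventually (\<lambda>w. deriv (deriv v) w + h0 w * v w = 0) (nhds 0)"
    by (auto simp: has_fps_expansion_def elim: eventually_mono)
  then obtain r1 where r1: "r1 > 0" "\<And>w. norm w < r1 \<Longrightarrow> deriv (deriv v) w + h0 w * v w = 0"
    by (auto simp: eventually_nhds_metric dist_norm)
  obtain r2 :: real where r2: "r2 > 0" "ereal r2 < fps_conv_radius F"
    using rad ereal_dense2[of 0] by auto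
  obtain r3 where r3: "r3 > 0" "ball z0 r3 \<subseteq> U"
    using assms open_contains_ball by blast
  \<comment> \<open>The equation is known within \<open>r1\<close>, the series converges within
    \<open>r2\<close>, and \<open>r3\<close> keeps the ball inside \<open>U\<close>.\<close>
  define r where "r = min r1 (min r2 r3)"
  define u where "u z = v (z - z0)" for z
  have v_holo: "v holomorphic_on ball 0 r" unfolding v_def
  proof (rule holomorphic_on_eval_fps, rule subsetI)
    fix x :: complex assume "x \<in> ball 0 r"
    then have "ereal (norm x) < ereal r2" by (simp add: r_def)
    with r2(2) have "ereal (norm x) < fps_conv_radius F" by (rule order.strict_trans[rotated])
    then show "x \<in> eball 0 (fps_conv_radius F)" by simp
  qed
  have du: "deriv u z = deriv v (z - z0)" for z
    using deriv_shift_0[of u z] deriv_shift_0[of v "z - z0"]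
    by (simp add: u_def[abs_def] o_def diff_add_eq)
  have ddu: "deriv (deriv u) z = deriv (deriv v) (z - z0)" for z
    using deriv_shift_0[of "deriv u" z] deriv_shift_0[of "deriv v" "z - z0"]
    by (simp add: du o_def diff_add_eq)
  show thesis
  proof
    show "r > 0" "ball z0 r \<subseteq> U" using r1 r2 r3 by (auto simp: r_def)
    have "u holomorphic_on ball z0 r" unfolding u_def
      by (rule holomorphic_on_compose_gen[of "\<lambda>w. w - z0" _ v "ball 0 r", unfolded o_def])
         (auto intro!: holomorphic_intros v_holo simp: dist_norm norm_minus_commute)
    moreover have "deriv (deriv u) z + h z * u z = 0" if "z \<in> ball z0 r" for z
    proof -
      have "norm (z - z0) < r1" using that by (simp add: r_def dist_norm norm_minus_commute)
      from r1(2)[OF this] show ?thesis by (simp add: ddu h0_def u_def)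
    qed
    ultimately show "ode_solution h (ball z0 r) u" by (simp add: ode_solution_def)
    show "u z0 = a" by (simp add: u_def v_def eval_fps_at_0 F_def)
    have "deriv v 0 = fps_nth F 1"
      using fps_nth_fps_expansion[OF v, of 1] by simp
    then show "deriv u z0 = b" by (simp add: du F_def)
  qed
qed

section \<open>Primitives, integrals along holomorphic curves, and branches of the square
  root\<close>

lemma simply_connected_primitive:
  assumes "open S" "simply_connected S" "f holomorphic_on S"
  obtains F where "\<And>z. z \<in> S \<Longrightarrow> (F has_field_derivative f z) (at z)"
proof -
  have "\<exists>F. \<forall>z. z \<in> S \<longrightarrow> (F has_field_derivative f z) (at z)"
    using assms(2,3) unfolding simply_connected_eq_global_primitive[OF assms(1)] by blast
  with that show thesis by metis
qed

text \<open>A path composed with a holomorphic map is again a valid path, here with image in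
  \<open>S\<close>; the primitive then leaves only the end points.\<close>

lemma contour_integral_holomorphic_curve:
  assumes F: "\<And>z. z \<in> S \<Longrightarrow> (F has_field_derivative f z) (at z)"
    and g: "holomorphic_curve S z0 z g"
  shows "contour_integral g f = F z - F z0"
proof -
  obtain V0 \<zeta> v where *: "open V0" "\<zeta> holomorphic_on V0" "\<zeta> ` V0 \<subseteq> S" "valid_path v"
    "path_image v \<subseteq> V0" "pathstart v = 0" "pathfinish v = 1" "\<zeta> 0 = z0" "\<zeta> 1 = z" "g = \<zeta> \<circ> v"
    using g unfolding holomorphic_curve_def by blast
  have "valid_path g" unfolding * using * by (intro valid_path_compose_holomorphic)
  moreover have "path_image g \<subseteq> S" using * by (auto simp: path_image_compose)
  ultimately have "(f has_contour_integral (F (pathfinish g) - F (pathstart g))) g"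
    using F by (intro contour_integral_primitive[of S]) (auto intro: has_field_derivative_at_within)
  then show ?thesis using * by (simp add: contour_integral_unique pathstart_compose pathfinish_compose)
qed

text \<open>\<open>sqrt_branch\<close> demands only continuity. Away from the zeros of
  \<open>D\<close> a continuous root is differentiable; the zeros are isolated because
  \<open>D\<close> is not identically zero on the connected set, and continuity makes them
  removable.\<close>

lemma sqrt_branch_holomorphic:
  assumes "open S" "connected S" "D holomorphic_on S" "\<beta> \<in> S" "D \<beta> \<noteq> 0" "sqrt_branch S D s"
  shows "s holomorphic_on S"
proof -
  have cont: "continuous_on S s" and sq: "\<And>z. z \<in> S \<Longrightarrow> (s z)\<^sup>2 = D z"
    using assms(6) by (auto simp: sqrt_branch_def)
  have nz: "s field_differentiable at z" if z: "z \<in> S" "D z \<noteq> 0" for z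
  proof -
    have "s z \<noteq> 0" using z sq by force
    have D: "(D has_field_derivative deriv D z) (at z)"
      using assms(1,3) z by (intro holomorphic_derivI)
    have lim: "(s \<longlongrightarrow> s z) (at z)"
      using cont assms(1) z by (metis continuous_on_eq_continuous_at isCont_def)
    \<comment> \<open>Since D y - D z = (s y - s z)(s y + s z), dividing by the second factor, which
      tends to 2 s z \<noteq> 0, yields the difference quotient of \<open>s\<close>.\<close>
    have "((\<lambda>y. (D y - D z) / (y - z) / (s y + s z)) \<longlongrightarrow> deriv D z / (s z + s z)) (at z)"
      using \<open>s z \<noteq> 0\<close> D by (intro tendsto_intros lim) (auto simp: has_field_derivative_iff)
    moreover have "eventually (\<lambda>y. s y + s z \<noteq> 0) (at z)"
      using \<open>s z \<noteq> 0\<close> by (intro tendsto_imp_eventually_ne[of _ "s z + s z"] tendsto_intros lim) auto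
    moreover have "eventually (\<lambda>y. y \<in> S) (at z)"
      using assms(1) z(1) by (simp add: eventually_at_in_open')
    ultimately have "((\<lambda>y. (s y - s z) / (y - z)) \<longlongrightarrow> deriv D z / (s z + s z)) (at z)"
    proof (elim Lim_transform_eventually, goal_cases)
      case 1
      then show ?case
      proof eventually_elim
        case (elim y)
        have "D y - D z = (s y - s z) * (s y + s z)"
          using sq[OF elim(2)] sq[OF z(1)] by (simp add: power2_eq_square algebra_simps)
        then show ?case using elim(1) by simp
      qed
    qed
    then show ?thesis
      by (auto simp: field_differentiable_def has_field_derivative_iff)
  qed
  have "s field_differentiable at z" if z: "z \<in> S" "D z = 0" for z
  proof -
    obtain r where r: "r > 0" "ball z r \<subseteq> S" "\<And>y. y \<in> ball z r - {z} \<Longrightarrow> D y \<noteq> 0"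
      using isolated_zeros[OF assms(3,1,2) z assms(4,5)] by blast
    have "s holomorphic_on ball z r"
    proof (rule no_isolated_singularity)
      show "continuous_on (ball z r) s" using cont r(2) continuous_on_subset by blast
      show "s holomorphic_on ball z r - {z}"
        unfolding holomorphic_on_def
      proof
        fix y assume y: "y \<in> ball z r - {z}"
        then have "s field_differentiable at y" using r(2,3) by (intro nz) auto
        then show "s field_differentiable at y within ball z r - {z}"
          by (rule field_differentiable_at_within)
      qed
    qed auto
    then show ?thesis using r(1) by (intro holomorphic_on_imp_differentiable_at[of _ "ball z r"]) auto
  qed
  then have "s field_differentiable at z" if "z \<in> S" for z using nz that by blast
  then show ?thesis unfolding holomorphic_on_def using field_differentiable_at_within by blast
qed

lemma constant_if_deriv_0:
  fixes f :: "complex \<Rightarrow> complex"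
  assumes "open S" "connected S" "\<And>z. z \<in> S \<Longrightarrow> (f has_field_derivative 0) (at z)" "x \<in> S" "y \<in> S"
  shows "f x = f y"
proof -
  obtain c where "\<And>x. x \<in> S \<Longrightarrow> f x = c"
    by (rule DERIV_zero_connected_constant[of S "{}" f])
       (use assms in \<open>auto intro: DERIV_isCont continuous_at_imp_continuous_on\<close>)
  then show ?thesis using assms by simp
qed

section \<open>Exponential solutions and Wronskians\<close>

text \<open>From u' = f u follows u'' = (f' + f^2) u, and \<open>u\<close> never vanishes, so it can
  be cancelled. The constant \<open>c\<close> stands for the value of the primitive at the starting
  point.\<close>

lemma ode_solution_exp_iff:
  assumes "open S" and F: "\<And>z. z \<in> S \<Longrightarrow> (F has_field_derivative f z) (at z)"
    and f: "f holomorphic_on S" and u: "\<And>z. z \<in> S \<Longrightarrow> u z = exp (F z - c)"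
  shows "ode_solution h S u \<longleftrightarrow> (\<forall>z\<in>S. deriv f z + (f z)\<^sup>2 + h z = 0)"
    and "\<And>z. z \<in> S \<Longrightarrow> (u has_field_derivative f z * u z) (at z)"
proof -
  show du: "(u has_field_derivative f z * u z) (at z)" if "z \<in> S" for z
  proof (rule has_field_derivative_transform_within_open[OF _ assms(1) that])
    show "((\<lambda>z. exp (F z - c)) has_field_derivative f z * u z) (at z)"
      using F[OF that] by (auto intro!: derivative_eq_intros simp: u[OF that])
  qed (simp add: u)
  have ddu: "deriv (deriv u) z = (deriv f z + (f z)\<^sup>2) * u z" if "z \<in> S" for z
  proof (rule DERIV_imp_deriv, rule has_field_derivative_transform_within_open[OF _ assms(1) that])
    show "((\<lambda>z. f z * u z) has_field_derivative (deriv f z + (f z)\<^sup>2) * u z) (at z)"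
      using holomorphic_derivI[OF f assms(1) that] du[OF that]
      by (auto intro!: derivative_eq_intros simp: power2_eq_square algebra_simps)
  qed (simp add: DERIV_imp_deriv[OF du])
  have "u holomorphic_on S" using du assms(1) by (meson holomorphic_on_open)
  moreover have "deriv (deriv u) z + h z * u z = (deriv f z + (f z)\<^sup>2 + h z) * u z" if "z \<in> S" for z
    by (simp add: ddu[OF that] algebra_simps)
  moreover have "u z \<noteq> 0" if "z \<in> S" for z using u[OF that] by simp
  ultimately show "ode_solution h S u \<longleftrightarrow> (\<forall>z\<in>S. deriv f z + (f z)\<^sup>2 + h z = 0)"
    by (auto simp: ode_solution_def)
qed

lemma ode_solution_derivs:
  assumes "open S" "ode_solution h S u" "z \<in> S"
  shows "(u has_field_derivative deriv u z) (at z)"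
    "(deriv u has_field_derivative - (h z * u z)) (at z)"
proof -
  have u: "u holomorphic_on S" and eq: "deriv (deriv u) z = - (h z * u z)"
    using assms by (auto simp: ode_solution_def eq_neg_iff_add_eq_0)
  show "(u has_field_derivative deriv u z) (at z)" using u assms by (intro holomorphic_derivI)
  show "(deriv u has_field_derivative - (h z * u z)) (at z)"
    using holomorphic_derivI[OF holomorphic_deriv[OF u assms(1)] assms(1,3)] eq by simp
qed

lemma ode_solution_linear:
  assumes "open S" "ode_solution h S u1" "ode_solution h S u2"
  shows "ode_solution h S (\<lambda>z. A * u1 z + B * u2 z)"
proof -
  let ?u = "\<lambda>z. A * u1 z + B * u2 z"
  note d1 = ode_solution_derivs[OF assms(1,2)] and d2 = ode_solution_derivs[OF assms(1,3)]
  have du: "(?u has_field_derivative A * deriv u1 z + B * deriv u2 z) (at z)" if "z \<in> S" for z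
    using d1(1)[OF that] d2(1)[OF that] by (auto intro!: derivative_eq_intros)
  have "deriv (deriv ?u) z = A * - (h z * u1 z) + B * - (h z * u2 z)" if "z \<in> S" for z
  proof (rule DERIV_imp_deriv, rule has_field_derivative_transform_within_open[OF _ assms(1) that])
    show "((\<lambda>z. A * deriv u1 z + B * deriv u2 z) has_field_derivative
        A * - (h z * u1 z) + B * - (h z * u2 z)) (at z)"
      using d1(2)[OF that] d2(2)[OF that] by (auto intro!: derivative_eq_intros)
  qed (simp add: DERIV_imp_deriv[OF du])
  moreover have "?u holomorphic_on S" using du assms(1) by (meson holomorphic_on_open)
  ultimately show ?thesis by (auto simp: ode_solution_def algebra_simps)
qed

text \<open>Abel's identity without first order term: u v'' - u'' v = - h u v + h u v = 0.\<close>

lemma wronskian_constant: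
  assumes "open S" "connected S" "ode_solution h S u" "ode_solution h S v" "x \<in> S" "y \<in> S"
  shows "u x * deriv v x - deriv u x * v x = u y * deriv v y - deriv u y * v y"
proof (rule constant_if_deriv_0[OF assms(1,2) _ assms(5,6), of "\<lambda>z. u z * deriv v z - deriv u z * v z"])
  fix z assume "z \<in> S"
  from ode_solution_derivs[OF assms(1,3) this] ode_solution_derivs[OF assms(1,4) this]
  show "((\<lambda>z. u z * deriv v z - deriv u z * v z) has_field_derivative 0) (at z)"
    by (auto intro!: derivative_eq_intros)
qed

text \<open>Cramer's rule. The coefficients of \<open>u\<close> are quotients of Wronskians, hence
  constants on the connected set.\<close>

lemma general_solution_if_wronskian:
  assumes "open S" "connected S" "ode_solution h S u1" "ode_solution h S u2" "z0 \<in> S"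
    and W0: "u1 z0 * deriv u2 z0 - deriv u1 z0 * u2 z0 \<noteq> 0"
  shows "general_solution h S u1 u2"
  unfolding general_solution_def
proof (intro conjI allI impI)
  show "ode_solution h S (\<lambda>z. A * u1 z + B * u2 z)" for A B
    using assms by (intro ode_solution_linear)
  fix u assume u: "ode_solution h S u"
  define W where "W = u1 z0 * deriv u2 z0 - deriv u1 z0 * u2 z0"
  \<comment> \<open>\<open>P\<close> and \<open>Q\<close> arise from \<open>W\<close> by putting
    \<open>u\<close> in place of \<open>u1\<close> and of \<open>u2\<close>, respectively.\<close>
  define P where "P = u z0 * deriv u2 z0 - deriv u z0 * u2 z0"
  define Q where "Q = u1 z0 * deriv u z0 - deriv u1 z0 * u z0"
  have "u z = P / W * u1 z + Q / W * u2 z" if z: "z \<in> S" for z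
  proof -
    have "W = u1 z * deriv u2 z - deriv u1 z * u2 z"
      "P = u z * deriv u2 z - deriv u z * u2 z" "Q = u1 z * deriv u z - deriv u1 z * u z"
      unfolding W_def P_def Q_def using assms u z by (auto intro!: wronskian_constant[of S h])
    then have "W * u z = P * u1 z + Q * u2 z" by algebra
    moreover have "W \<noteq> 0" using W0 by (simp add: W_def)
    ultimately show ?thesis by (simp add: divide_simps mult.commute)
  qed
  then show "\<exists>A B. \<forall>z\<in>S. u z = A * u1 z + B * u2 z" by blast
qed

subsection \<open>Riccati equations and the geodesic equation\<close>

text \<open>The conditions on \<open>X\<close> say that the points (z, X z) with \<open>z\<close> in
  \<open>S\<close> lie where the metric is defined and nondegenerate.\<close>

locale nondegenerate_profile =
  fixes h X :: "complex \<Rightarrow> complex" and S :: "complex set"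
  assumes open_S: "open S" and h: "h holomorphic_on S" and X: "X holomorphic_on S"
    and X_nz: "z \<in> S \<Longrightarrow> X z \<noteq> 0" and h_neq: "z \<in> S \<Longrightarrow> h z \<noteq> (X z)\<^sup>2"
begin

definition w :: "complex \<Rightarrow> complex" where "w z = h z - (X z)\<^sup>2"

text \<open>The sum of the two integrands, written without the square root so that it is available
  before a branch exists.\<close>

definition p :: "complex \<Rightarrow> complex" where "p z = 2 * X z * deriv X z / w z"

lemma w_nz: "z \<in> S \<Longrightarrow> w z \<noteq> 0"
  using h_neq by (simp add: w_def)

lemma holomorphic_data [holomorphic_intros]:
  "deriv X holomorphic_on S" "deriv h holomorphic_on S" "w holomorphic_on S" "p holomorphic_on S"
proof -
  show "deriv X holomorphic_on S" "deriv h holomorphic_on S"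
    using X h open_S by (auto intro: holomorphic_deriv)
  then show "w holomorphic_on S" "p holomorphic_on S"
    unfolding p_def w_def using h_neq by (auto intro!: holomorphic_intros h X)
qed

lemma DERIVs:
  assumes "z \<in> S"
  shows X_DERIV: "(X has_field_derivative deriv X z) (at z)"
    and X'_DERIV: "(deriv X has_field_derivative deriv (deriv X) z) (at z)"
    and h_DERIV: "(h has_field_derivative deriv h z) (at z)"
    and w_DERIV: "(w has_field_derivative deriv h z - 2 * X z * deriv X z) (at z)"
    and p_DERIV: "(p has_field_derivative deriv p z) (at z)"
    and deriv_p: "deriv p z = 2 * ((deriv X z)\<^sup>2 + X z * deriv (deriv X) z) / w z
      - 2 * X z * deriv X z * (deriv h z - 2 * X z * deriv X z) / (w z)\<^sup>2"
proof -
  show dX: "(X has_field_derivative deriv X z) (at z)"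
    and dX': "(deriv X has_field_derivative deriv (deriv X) z) (at z)"
    and dh: "(h has_field_derivative deriv h z) (at z)"
    and dp: "(p has_field_derivative deriv p z) (at z)"
    using assms open_S holomorphic_data h X by (auto intro: holomorphic_derivI)
  show dw: "(w has_field_derivative deriv h z - 2 * X z * deriv X z) (at z)"
    unfolding w_def[abs_def] by (rule derivative_eq_intros dh dX refl)+ simp
  show "deriv p z = 2 * ((deriv X z)\<^sup>2 + X z * deriv (deriv X) z) / w z
      - 2 * X z * deriv X z * (deriv h z - 2 * X z * deriv X z) / (w z)\<^sup>2"
    by (rule DERIV_imp_deriv, unfold p_def[abs_def])
       (rule derivative_eq_intros dw dX dX' refl w_nz assms |
        simp add: w_nz[OF assms] field_simps power2_eq_square)+
qed

text \<open>As the integrands have sum \<open>p\<close> and product - X^2, the expression on the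
  right is the sum of their two Riccati residuals.\<close>

lemma geodesic_ode_iff:
  "geodesic_ode h S X \<longleftrightarrow> (\<forall>z\<in>S. deriv p z + (p z)\<^sup>2 + 2 * (X z)\<^sup>2 + 2 * h z = 0)"
  unfolding geodesic_ode_def
proof (rule ball_cong[OF refl])
  fix z assume z: "z \<in> S"
  define x v a b k where "x = X z" and "v = w z" and "a = deriv X z" and "b = deriv (deriv X) z"
    and "k = deriv h z"
  have nz: "x \<noteq> 0" "v \<noteq> 0" using z X_nz w_nz by (auto simp: x_def v_def)
  \<comment> \<open>Trading \<open>h z\<close> for \<open>v\<close> leaves only \<open>x\<close> and
    \<open>v\<close> as denominators.\<close>
  have h_eq: "h z = v + x\<^sup>2" by (simp add: v_def x_def w_def)
  define c where "c = (3 * x\<^sup>2 + h z) / (x\<^sup>2 - h z) * (a\<^sup>2 / x) - k * a / (x\<^sup>2 - h z) + (x ^ 4 - (h z)\<^sup>2) / x"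
  have c: "c = - ((4 * x\<^sup>2 + v) * a\<^sup>2 / (v * x)) + k * a / v - v * (v + 2 * x\<^sup>2) / x"
    using nz by (simp add: c_def h_eq field_simps) algebra
  \<comment> \<open>X'' enters p' with the nonzero coefficient \<open>2 * x / v\<close>, so the two
    equations differ by just this factor.\<close>
  have "deriv p z + (p z)\<^sup>2 + 2 * x\<^sup>2 + 2 * h z = 2 * x / v * (b - c)"
    unfolding c using nz
    by (simp add: deriv_p[OF z] p_def h_eq field_simps flip: x_def v_def a_def b_def k_def) algebra
  then have "b = c \<longleftrightarrow> deriv p z + (p z)\<^sup>2 + 2 * x\<^sup>2 + 2 * h z = 0" using nz by simp
  then show "(deriv (deriv X) z = (3 * (X z)\<^sup>2 + h z) / ((X z)\<^sup>2 - h z) * ((deriv X z)\<^sup>2 / X z)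
      - deriv h z * deriv X z / ((X z)\<^sup>2 - h z) + ((X z) ^ 4 - (h z)\<^sup>2) / X z)
      \<longleftrightarrow> (deriv p z + (p z)\<^sup>2 + 2 * (X z)\<^sup>2 + 2 * h z = 0)"
    unfolding b_def c_def a_def k_def x_def .
qed

lemma discr_eq: "z \<in> S \<Longrightarrow> discr h X z = (w z)\<^sup>2 / (4 * (X z)\<^sup>2) * ((p z)\<^sup>2 + 4 * (X z)\<^sup>2)"
  using w_nz[of z] X_nz[of z] by (simp add: discr_def p_def field_simps flip: w_def)

text \<open>With a primitive \<open>P\<close> of \<open>p\<close>, the equation \<delta>' = - 2 p
  \<delta> makes \<delta> exp(2 P) a constant \<open>c\<close>. Hence one nonzero value suffices for
  all, and a root of \<delta> can be written down.\<close>

lemma sqrt_branch_if_geodesic_ode: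
  assumes "simply_connected S" "geodesic_ode h S X" "z1 \<in> S" "discr h X z1 \<noteq> 0"
  shows "\<exists>s. sqrt_branch S (discr h X) s" and "z \<in> S \<Longrightarrow> discr h X z \<noteq> 0"
proof -
  obtain P where P: "\<And>z. z \<in> S \<Longrightarrow> (P has_field_derivative p z) (at z)"
    using simply_connected_primitive[OF open_S assms(1) holomorphic_data(4)] by blast
  define \<delta> where "\<delta> z = (p z)\<^sup>2 + 4 * (X z)\<^sup>2" for z
  define c where "c = \<delta> z1 * exp (2 * P z1)"
  have \<delta>_eq: "\<delta> z * exp (2 * P z) = c" if "z \<in> S" for z
    unfolding c_def
  proof (rule constant_if_deriv_0[OF open_S _ _ that assms(3), of "\<lambda>z. \<delta> z * exp (2 * P z)"])
    show "connected S" using assms(1) by (rule simply_connected_imp_connected)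
    fix y assume y: "y \<in> S"
    have "2 * X y * deriv X y = w y * p y" using w_nz[OF y] by (simp add: p_def)
    moreover have "deriv p y + (p y)\<^sup>2 + 2 * (X y)\<^sup>2 + 2 * h y = 0"
      using assms(2) y unfolding geodesic_ode_iff by blast
    ultimately have *: "2 * p y * deriv p y + 8 * X y * deriv X y = - 2 * p y * \<delta> y"
      unfolding \<delta>_def w_def by algebra
    have "((\<lambda>z. \<delta> z * exp (2 * P z)) has_field_derivative
        (2 * p y * deriv p y + 8 * X y * deriv X y) * exp (2 * P y) + \<delta> y * (2 * p y * exp (2 * P y))) (at y)"
      unfolding \<delta>_def[abs_def]
      by (rule derivative_eq_intros p_DERIV X_DERIV P y refl | simp)+
    then show "((\<lambda>z. \<delta> z * exp (2 * P z)) has_field_derivative 0) (at y)"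
      unfolding * by simp
  qed
  have "c \<noteq> 0" using assms(3,4) discr_eq[OF assms(3)] by (auto simp: c_def \<delta>_def)
  then show "discr h X z \<noteq> 0" if "z \<in> S" for z
    using \<delta>_eq[OF that] w_nz[OF that] X_nz[OF that] discr_eq[OF that] by (auto simp: \<delta>_def)
  \<comment> \<open>Only the constant \<open>c\<close> is put under \<open>csqrt\<close>, so its
    branch cut causes no discontinuity in \<open>z\<close>.\<close>
  define s where "s z = w z / (2 * X z) * (csqrt c * exp (- P z))" for z
  have "P holomorphic_on S" using P open_S by (meson holomorphic_on_open)
  then have "s holomorphic_on S"
    unfolding s_def using X_nz by (intro holomorphic_intros X) auto
  moreover have "(s z)\<^sup>2 = discr h X z" if "z \<in> S" for z
  proof -
    have "\<delta> z = c * exp (- P z) ^ 2"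
      using \<delta>_eq[OF that, symmetric] exp_double[of "P z"] by (simp add: exp_minus field_simps)
    then show ?thesis
      using X_nz[OF that] by (simp add: discr_eq[OF that] s_def power_mult_distrib power_divide flip: \<delta>_def)
  qed
  ultimately have "sqrt_branch S (discr h X) s"
    by (simp add: sqrt_branch_def holomorphic_on_imp_continuous_on)
  then show "\<exists>s. sqrt_branch S (discr h X) s" by blast
qed

section \<open>The two integrands and their Riccati residuals\<close>

definition f_top :: "(complex \<Rightarrow> complex) \<Rightarrow> complex \<Rightarrow> complex" where
  "f_top s z = X z * ((deriv X z - s z) / (h z - (X z)\<^sup>2))"

definition f_bot :: "(complex \<Rightarrow> complex) \<Rightarrow> complex \<Rightarrow> complex" where
  "f_bot s z = X z * ((deriv X z + s z) / (h z - (X z)\<^sup>2))"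

lemma f_top_add_f_bot: "z \<in> S \<Longrightarrow> f_top s z + f_bot s z = p z"
  using w_nz[of z] by (simp add: f_top_def f_bot_def p_def field_simps flip: w_def)

text \<open>(X' - s)(X' + s) = X'^2 - s^2 = - w^2.\<close>

lemma f_top_mult_f_bot:
  assumes "z \<in> S" "(s z)\<^sup>2 = discr h X z"
  shows "f_top s z * f_bot s z = - (X z)\<^sup>2"
proof -
  have "(s z)\<^sup>2 = (w z)\<^sup>2 + (deriv X z)\<^sup>2" using assms by (simp add: discr_def w_def)
  then show ?thesis
    using w_nz[OF assms(1)] by (simp add: f_top_def f_bot_def field_simps flip: w_def) algebra
qed

context
  fixes s
  assumes s: "s holomorphic_on S" "z \<in> S \<Longrightarrow> (s z)\<^sup>2 = discr h X z"
begin

lemma f_holo: "f_top s holomorphic_on S" "f_bot s holomorphic_on S"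
  unfolding f_top_def f_bot_def using h_neq by (auto intro!: holomorphic_intros h X s)

text \<open>Write f1, f2 for the integrands. The first identity uses f1^2 + f2^2 = p^2 + 2 X^2. In
  the second, E1 f2 + E2 f1 = (f1 f2)' + (f1 f2 + h) p = - 2 X X' + w p, which is 0 by the
  definition of \<open>p\<close>.\<close>

lemma riccati_residuals:
  assumes "z \<in> S"
  defines "E1 \<equiv> deriv (f_top s) z + (f_top s z)\<^sup>2 + h z"
    and "E2 \<equiv> deriv (f_bot s) z + (f_bot s z)\<^sup>2 + h z"
  shows "E1 + E2 = deriv p z + (p z)\<^sup>2 + 2 * (X z)\<^sup>2 + 2 * h z"
    and "E1 * f_bot s z + E2 * f_top s z = 0"
proof -
  note d = holomorphic_derivI[OF f_holo(1) open_S assms(1)] holomorphic_derivI[OF f_holo(2) open_S assms(1)]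
  note sum = f_top_add_f_bot[OF assms(1), of s] and prod = f_top_mult_f_bot[of z s, OF assms(1) s(2)[OF assms(1)]]
  have "(p has_field_derivative deriv (f_top s) z + deriv (f_bot s) z) (at z)"
    by (rule has_field_derivative_transform_within_open[OF DERIV_add[OF d] open_S assms(1)])
       (rule f_top_add_f_bot)
  then have sum': "deriv p z = deriv (f_top s) z + deriv (f_bot s) z" by (rule DERIV_imp_deriv)
  then show "E1 + E2 = deriv p z + (p z)\<^sup>2 + 2 * (X z)\<^sup>2 + 2 * h z"
    using sum prod unfolding E1_def E2_def by algebra
  have "((\<lambda>z. - (X z)\<^sup>2) has_field_derivative
      deriv (f_top s) z * f_bot s z + f_top s z * deriv (f_bot s) z) (at z)"
    by (rule has_field_derivative_transform_within_open[OF _ open_S assms(1),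
          of "\<lambda>z. f_top s z * f_bot s z"])
       (auto intro!: derivative_eq_intros d f_top_mult_f_bot s)
  moreover have "((\<lambda>z. - (X z)\<^sup>2) has_field_derivative - 2 * X z * deriv X z) (at z)"
    by (rule derivative_eq_intros X_DERIV assms(1) refl | simp)+
  ultimately have "deriv (f_top s) z * f_bot s z + f_top s z * deriv (f_bot s) z = - 2 * X z * deriv X z"
    by (rule DERIV_unique)
  also have "\<dots> = - (w z * p z)" using w_nz[OF assms(1)] by (simp add: p_def)
  finally show "E1 * f_bot s z + E2 * f_top s z = 0"
    using sum prod unfolding E1_def E2_def w_def by algebra
qed

text \<open>Under the geodesic equation the residuals satisfy two homogeneous linear equations whose
  determinant is, up to sign, f_bot - f_top = 2 X s / w. It is nonzero because the discriminant
  is.\<close>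

lemma riccati_iff_geodesic_ode:
  assumes "geodesic_ode h S X \<Longrightarrow> \<forall>z\<in>S. discr h X z \<noteq> 0"
  shows "(\<forall>z\<in>S. deriv (f_top s) z + (f_top s z)\<^sup>2 + h z = 0) \<and>
         (\<forall>z\<in>S. deriv (f_bot s) z + (f_bot s z)\<^sup>2 + h z = 0) \<longleftrightarrow> geodesic_ode h S X"
proof
  assume ode: "geodesic_ode h S X"
  have "deriv (f_top s) z + (f_top s z)\<^sup>2 + h z = 0 \<and> deriv (f_bot s) z + (f_bot s z)\<^sup>2 + h z = 0"
    if z: "z \<in> S" for z
  proof -
    define E1 E2 where "E1 = deriv (f_top s) z + (f_top s z)\<^sup>2 + h z"
      and "E2 = deriv (f_bot s) z + (f_bot s z)\<^sup>2 + h z"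
    note residuals = riccati_residuals[OF z, folded E1_def E2_def]
    have "s z \<noteq> 0" using assms[OF ode] s(2)[OF z] z by auto
    then have "f_bot s z - f_top s z \<noteq> 0"
      using X_nz[OF z] w_nz[OF z] by (simp add: f_bot_def f_top_def field_simps flip: w_def)
    moreover have "E1 + E2 = 0"
      using residuals(1) ode z unfolding geodesic_ode_iff by simp
    moreover from this residuals(2) have "E1 * (f_bot s z - f_top s z) = 0"
      by algebra
    ultimately have "E1 = 0 \<and> E2 = 0" by simp
    then show ?thesis unfolding E1_def E2_def .
  qed
  then show "(\<forall>z\<in>S. deriv (f_top s) z + (f_top s z)\<^sup>2 + h z = 0) \<and>
      (\<forall>z\<in>S. deriv (f_bot s) z + (f_bot s z)\<^sup>2 + h z = 0)" by blast
next
  assume "(\<forall>z\<in>S. deriv (f_top s) z + (f_top s z)\<^sup>2 + h z = 0) \<and>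
      (\<forall>z\<in>S. deriv (f_bot s) z + (f_bot s z)\<^sup>2 + h z = 0)"
  then show "geodesic_ode h S X"
    unfolding geodesic_ode_iff by (auto simp flip: riccati_residuals(1))
qed

end

section \<open>The equivalence and the independence of the curve\<close>

text \<open>On the simply connected set both integrands have primitives, so both exponents are
  differences of values at \<open>z\<close> and \<open>z0\<close>. This settles curve independence
  and reduces the equivalence to the Riccati equations; a Wronskian gives completeness.\<close>

lemma
  assumes "simply_connected S" "z0 \<in> S" "\<exists>z\<in>S. discr h X z \<noteq> 0"
    and s: "sqrt_branch S (discr h X) s"
  shows general_solution_iff_geodesic_ode:
      "\<lbrakk>\<And>z. z \<in> S \<Longrightarrow> holomorphic_curve S z0 z (\<gamma> z)\<rbrakk> \<Longrightarrow>
       general_solution h S (\<lambda>z. u_top h X s (\<gamma> z)) (\<lambda>z. u_bot h X s (\<gamma> z)) \<longleftrightarrow> geodesic_ode h S X"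
    and u_curve_independent:
      "\<lbrakk>holomorphic_curve S z0 z \<gamma>1; holomorphic_curve S z0 z \<gamma>2\<rbrakk> \<Longrightarrow>
       u_top h X s \<gamma>1 = u_top h X s \<gamma>2 \<and> u_bot h X s \<gamma>1 = u_bot h X s \<gamma>2"
proof -
  obtain z1 where z1: "z1 \<in> S" "discr h X z1 \<noteq> 0" using assms by blast
  have conn: "connected S" using assms(1) by (rule simply_connected_imp_connected)
  have "discr h X holomorphic_on S"
    unfolding discr_def[abs_def] by (intro holomorphic_intros h X)
  then have s_holo: "s holomorphic_on S"
    by (rule sqrt_branch_holomorphic[OF open_S conn _ z1 s])
  have s_sq: "(s z)\<^sup>2 = discr h X z" if "z \<in> S" for z
    using s that by (simp add: sqrt_branch_def)
  note f_holo = f_holo[OF s_holo s_sq]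
  obtain F1 where F1: "\<And>z. z \<in> S \<Longrightarrow> (F1 has_field_derivative f_top s z) (at z)"
    using simply_connected_primitive[OF open_S assms(1) f_holo(1)] by blast
  obtain F2 where F2: "\<And>z. z \<in> S \<Longrightarrow> (F2 has_field_derivative f_bot s z) (at z)"
    using simply_connected_primitive[OF open_S assms(1) f_holo(2)] by blast
  have u_top: "u_top h X s g = exp (F1 z - F1 z0)" and u_bot: "u_bot h X s g = exp (F2 z - F2 z0)"
    if "holomorphic_curve S z0 z g" for z g
    using contour_integral_holomorphic_curve[OF F1 that] contour_integral_holomorphic_curve[OF F2 that]
    by (simp_all add: u_top_def u_bot_def f_top_def[abs_def] f_bot_def[abs_def])
  show "u_top h X s \<gamma>1 = u_top h X s \<gamma>2 \<and> u_bot h X s \<gamma>1 = u_bot h X s \<gamma>2"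
    if "holomorphic_curve S z0 z \<gamma>1" "holomorphic_curve S z0 z \<gamma>2"
    using u_top u_bot that by metis
  assume \<gamma>: "\<And>z. z \<in> S \<Longrightarrow> holomorphic_curve S z0 z (\<gamma> z)"
  let ?u1 = "\<lambda>z. u_top h X s (\<gamma> z)" and ?u2 = "\<lambda>z. u_bot h X s (\<gamma> z)"
  note u1 = ode_solution_exp_iff[where u = ?u1 and c = "F1 z0", OF open_S F1 f_holo(1) u_top[OF \<gamma>]]
  note u2 = ode_solution_exp_iff[where u = ?u2 and c = "F2 z0", OF open_S F2 f_holo(2) u_bot[OF \<gamma>]]
  have nz: "geodesic_ode h S X \<Longrightarrow> \<forall>z\<in>S. discr h X z \<noteq> 0"
    using sqrt_branch_if_geodesic_ode(2)[OF assms(1) _ z1] by blast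
  have "geodesic_ode h S X \<longleftrightarrow> ode_solution h S ?u1 \<and> ode_solution h S ?u2"
    using riccati_iff_geodesic_ode[OF s_holo s_sq nz] u1(1) u2(1) by simp
  moreover have "general_solution h S ?u1 ?u2" if "ode_solution h S ?u1" "ode_solution h S ?u2"
      "geodesic_ode h S X"
  proof (rule general_solution_if_wronskian[OF open_S conn that(1,2) assms(2)])
    have "s z0 \<noteq> 0" using nz[OF that(3)] s_sq[OF assms(2)] assms(2) by auto
    then have "f_bot s z0 - f_top s z0 \<noteq> 0"
      using X_nz[OF assms(2)] w_nz[OF assms(2)] by (simp add: f_bot_def f_top_def field_simps flip: w_def)
    moreover have "?u1 z0 \<noteq> 0" "?u2 z0 \<noteq> 0" by (simp_all add: u_top_def u_bot_def)
    ultimately have "?u1 z0 * ?u2 z0 * (f_bot s z0 - f_top s z0) \<noteq> 0" by simp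
    \<comment> \<open>Both functions satisfy u' = f u, so the Wronskian factors.\<close>
    also have "?u1 z0 * ?u2 z0 * (f_bot s z0 - f_top s z0)
        = ?u1 z0 * deriv ?u2 z0 - deriv ?u1 z0 * ?u2 z0"
      using DERIV_imp_deriv[OF u1(2)] DERIV_imp_deriv[OF u2(2)] assms(2) by (simp add: algebra_simps)
    finally show "?u1 z0 * deriv ?u2 z0 - deriv ?u1 z0 * ?u2 z0 \<noteq> 0" .
  qed
  moreover have "ode_solution h S ?u1 \<and> ode_solution h S ?u2" if "general_solution h S ?u1 ?u2"
  proof -
    have *: "ode_solution h S (\<lambda>z. A * ?u1 z + B * ?u2 z)" for A B
      using that by (simp add: general_solution_def)
    show ?thesis using *[of 1 0] *[of 0 1] by simp
  qed
  ultimately show "general_solution h S ?u1 ?u2 \<longleftrightarrow> geodesic_ode h S X" by blast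
qed

end

subsection \<open>Geodesics of the metric\<close>

text \<open>\<open>matrix_inv\<close> is defined by choice; associativity identifies the chosen
  inverse with \<open>N\<close>.\<close>

lemma matrix_inv_unique:
  fixes M :: "'a::semiring_1^'n^'n"
  assumes "M ** N = mat 1" "N ** M = mat 1"
  shows "matrix_inv M = N"
proof -
  have "M ** matrix_inv M = mat 1 \<and> matrix_inv M ** M = mat 1"
    unfolding matrix_inv_def by (rule someI[of _ N]) (use assms in blast)
  then have "matrix_inv M = matrix_inv M ** (M ** N)" "matrix_inv M ** M ** N = N"
    using assms by simp_all
  then show ?thesis by (simp add: matrix_mul_assoc)
qed

lemma matrix_inv_diag_2:
  fixes a b :: "'a::field"
  assumes "a \<noteq> 0" "b \<noteq> 0"
  shows "matrix_inv (vector [vector [a, 0], vector [0, b]] :: 'a^2^2)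
    = vector [vector [1 / a, 0], vector [0, 1 / b]]"
  by (rule matrix_inv_unique)
     (use assms in \<open>auto simp: vec_eq_iff forall_2 matrix_matrix_mult_def mat_def sum_2\<close>)

lemma complex_partial_Gmetric:
  fixes q :: "complex^2"
  assumes "h field_differentiable at (q $ 1)" "q $ 2 \<noteq> 0"
  defines "v \<equiv> h (q $ 1) - (q $ 2)\<^sup>2"
  shows "complex_partial 1 (\<lambda>q. Gmetric h q $ 1 $ 1) q = 2 * v * deriv h (q $ 1) / (q $ 2)\<^sup>2"
    and "complex_partial 2 (\<lambda>q. Gmetric h q $ 1 $ 1) q = - 4 * v / (q $ 2) - 2 * v\<^sup>2 / (q $ 2) ^ 3"
    and "complex_partial 1 (\<lambda>q. Gmetric h q $ 2 $ 2) q = 0"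
    and "complex_partial 2 (\<lambda>q. Gmetric h q $ 2 $ 2) q = - 2 / (q $ 2) ^ 3"
    and "complex_partial i (\<lambda>q. Gmetric h q $ 1 $ 2) q = 0"
    and "complex_partial i (\<lambda>q. Gmetric h q $ 2 $ 1) q = 0"
proof -
  define z x where "z = q $ 1" and "x = q $ 2"
  have x: "x \<noteq> 0" using assms(2) by (simp add: x_def)
  have ax: "axis 1 t $ (2::2) = 0" "axis 2 t $ (1::2) = 0" for t :: complex by (auto simp: axis_def)
  have dh: "((\<lambda>t. h (z + t)) has_field_derivative deriv h z) (at 0)"
    using assms(1) DERIV_shift[of h "deriv h z" 0 z]
    by (simp add: field_differentiable_derivI z_def add.commute)
  note unfolds = complex_partial_def Gmetric_def vector_2 vector_add_component axis_nth ax
    add_0_right v_def z_def[symmetric] x_def[symmetric]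
  show "complex_partial 1 (\<lambda>q. Gmetric h q $ 1 $ 1) q = 2 * v * deriv h (q $ 1) / (q $ 2)\<^sup>2"
    unfolding unfolds by (intro DERIV_imp_deriv DERIV_cdivide) (auto intro!: derivative_eq_intros dh)
  show "complex_partial 2 (\<lambda>q. Gmetric h q $ 1 $ 1) q = - 4 * v / (q $ 2) - 2 * v\<^sup>2 / (q $ 2) ^ 3"
    unfolding unfolds
    by (rule DERIV_imp_deriv)
       (use x in \<open>auto intro!: derivative_eq_intros simp: field_simps power2_eq_square power3_eq_cube\<close>)
  show "complex_partial 1 (\<lambda>q. Gmetric h q $ 2 $ 2) q = 0"
    unfolding unfolds by simp
  show "complex_partial 2 (\<lambda>q. Gmetric h q $ 2 $ 2) q = - 2 / (q $ 2) ^ 3"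
    unfolding unfolds
    by (rule DERIV_imp_deriv)
       (use x in \<open>auto intro!: derivative_eq_intros simp: field_simps power2_eq_square power3_eq_cube\<close>)
  show "complex_partial i (\<lambda>q. Gmetric h q $ 1 $ 2) q = 0"
    "complex_partial i (\<lambda>q. Gmetric h q $ 2 $ 1) q = 0"
    unfolding unfolds by simp_all
qed

text \<open>The metric is diagonal, so only l = k contributes. The symbols 1 1 1, 1 1 2 and 2 2 2
  are half logarithmic derivatives of diagonal entries; 2 1 1 is - G11,2 / (2 G22).\<close>

lemma christoffel_Gmetric:
  fixes q :: "complex^2"
  assumes "h field_differentiable at (q $ 1)" "q $ 2 \<noteq> 0"
  defines "v \<equiv> h (q $ 1) - (q $ 2)\<^sup>2"
  assumes "v \<noteq> 0"
  shows "christoffel (Gmetric h) 1 1 1 q = deriv h (q $ 1) / v"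
    and "christoffel (Gmetric h) 1 1 2 q = - 2 * q $ 2 / v - 1 / q $ 2"
    and "christoffel (Gmetric h) 1 2 1 q = - 2 * q $ 2 / v - 1 / q $ 2"
    and "christoffel (Gmetric h) 1 2 2 q = 0"
    and "christoffel (Gmetric h) 2 1 1 q = 2 * q $ 2 * v + v\<^sup>2 / q $ 2"
    and "christoffel (Gmetric h) 2 1 2 q = 0"
    and "christoffel (Gmetric h) 2 2 1 q = 0"
    and "christoffel (Gmetric h) 2 2 2 q = - 1 / q $ 2"
proof -
  have inv: "matrix_inv (Gmetric h q) = vector [vector [(q $ 2)\<^sup>2 / v\<^sup>2, 0], vector [0, (q $ 2)\<^sup>2]]"
    unfolding Gmetric_def using assms by (subst matrix_inv_diag_2) (auto simp: v_def)
  note simps = christoffel_def inv sum_2 vector_2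
    complex_partial_Gmetric[OF assms(1,2)] v_def[symmetric]
  show "christoffel (Gmetric h) 1 1 1 q = deriv h (q $ 1) / v"
    "christoffel (Gmetric h) 1 1 2 q = - 2 * q $ 2 / v - 1 / q $ 2"
    "christoffel (Gmetric h) 1 2 1 q = - 2 * q $ 2 / v - 1 / q $ 2"
    "christoffel (Gmetric h) 1 2 2 q = 0"
    "christoffel (Gmetric h) 2 1 1 q = 2 * q $ 2 * v + v\<^sup>2 / q $ 2"
    "christoffel (Gmetric h) 2 1 2 q = 0"
    "christoffel (Gmetric h) 2 2 1 q = 0"
    "christoffel (Gmetric h) 2 2 2 q = - 1 / q $ 2"
    unfolding simps using assms(2,4)
    by (simp_all add: field_simps power2_eq_square power3_eq_cube)
qed

lemma simply_connected_ball: "simply_connected (ball (z::complex) r)"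
  by (simp add: convex_imp_simply_connected)

section \<open>From the explicit equation back to a geodesic with affine parameter\<close>

context nondegenerate_profile
begin

text \<open>\<open>z\<close> solves \<open>z'' + K(z) z'\<^sup>2 = 0\<close>, the first geodesic equation, precisely when the affine parameter
  has \<open>dv/dz\<close> proportional to \<open>exp (\<integral> K)\<close>.\<close>

definition K :: "complex \<Rightarrow> complex" where
  "K z = deriv h z / w z - 2 * (2 * X z / w z + 1 / X z) * deriv X z"

text \<open>This is the second geodesic equation for x(v) = X(z(v)), divided by z'^2, after z'' = -
  K z'^2 has been inserted in x'' = X'' z'^2 + X' z''.\<close>

lemma geodesic_ode_K:
  assumes "geodesic_ode h S X" "z \<in> S"
  shows "deriv (deriv X) z - deriv X z * K z + (2 * X z * w z + (w z)\<^sup>2 / X z)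
    - (deriv X z)\<^sup>2 / X z = 0"
proof -
  define x v a b k where "x = X z" and "v = w z" and "a = deriv X z" and "b = deriv (deriv X) z"
    and "k = deriv h z"
  have nz: "x \<noteq> 0" "v \<noteq> 0" using assms X_nz w_nz by (auto simp: x_def v_def)
  have h_eq: "h z = v + x\<^sup>2" by (simp add: v_def x_def w_def)
  have "b = (3 * x\<^sup>2 + h z) / (x\<^sup>2 - h z) * (a\<^sup>2 / x) - k * a / (x\<^sup>2 - h z) + (x ^ 4 - (h z)\<^sup>2) / x"
    using assms by (simp add: geodesic_ode_def x_def a_def b_def k_def)
  then show ?thesis
    using nz unfolding K_def x_def[symmetric] a_def[symmetric] b_def[symmetric] k_def[symmetric]
      v_def[symmetric] h_eq
    by (simp add: field_simps) algebra
qed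

text \<open>The affine parameter is built first, as a function \<Phi> of \<open>z\<close> with
  \<Phi>' = exp(Q) and Q' = K. Its local inverse \<zeta> is the \<open>z\<close>-component of the
  geodesic.\<close>

lemma explicit_geodesic_local:
  assumes "simply_connected S" "geodesic_ode h S X" "z0 \<in> S" "S \<subseteq> U"
  obtains r where "r > 0" "ball z0 r \<subseteq> S" "explicit_geodesic h U (ball z0 r) z0 X"
proof -
  have K: "K holomorphic_on S" unfolding K_def
    using X_nz w_nz by (auto intro!: holomorphic_intros h X)
  obtain Q where Q: "\<And>z. z \<in> S \<Longrightarrow> (Q has_field_derivative K z) (at z)"
    using simply_connected_primitive[OF open_S assms(1) K] by blast
  define \<phi> where "\<phi> z = exp (Q z)" for z
  have \<phi>_DERIV: "(\<phi> has_field_derivative K z * \<phi> z) (at z)" if "z \<in> S" for z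
    unfolding \<phi>_def[abs_def] by (rule derivative_eq_intros Q that refl | simp)+
  then have "\<phi> holomorphic_on S" using open_S by (meson holomorphic_on_open)
  then obtain \<Phi>0 where \<Phi>0: "\<And>z. z \<in> S \<Longrightarrow> (\<Phi>0 has_field_derivative \<phi> z) (at z)"
    using simply_connected_primitive[OF open_S assms(1)] by blast
  \<comment> \<open>The shift places \<open>z0\<close> at parameter value 0.\<close>
  define \<Phi> where "\<Phi> z = \<Phi>0 z - \<Phi>0 z0" for z
  have \<Phi>_DERIV: "(\<Phi> has_field_derivative \<phi> z) (at z)" if "z \<in> S" for z
    unfolding \<Phi>_def[abs_def] by (rule derivative_eq_intros \<Phi>0 that refl | simp)+
  have \<Phi>: "\<Phi> holomorphic_on S" using \<Phi>_DERIV open_S by (meson holomorphic_on_open)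
  have "deriv \<Phi> z0 \<noteq> 0" using DERIV_imp_deriv[OF \<Phi>_DERIV[OF assms(3)]] by (simp add: \<phi>_def)
  then obtain r where r: "r > 0" "ball z0 r \<subseteq> S" "inj_on \<Phi> (ball z0 r)"
    using has_complex_derivative_locally_injective[OF \<Phi> assms(3) open_S] by blast
  define B where "B = ball z0 r"
  define V where "V = \<Phi> ` B"
  have B: "open B" "B \<subseteq> S" "inj_on \<Phi> B" "\<Phi> holomorphic_on B"
    using r \<Phi> holomorphic_on_subset by (auto simp: B_def)
  obtain \<zeta> where \<zeta>: "\<zeta> holomorphic_on V" "\<And>z. z \<in> B \<Longrightarrow> deriv \<Phi> z * deriv \<zeta> (\<Phi> z) = 1"
    "\<And>z. z \<in> B \<Longrightarrow> \<zeta> (\<Phi> z) = z"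
    using holomorphic_has_inverse[OF B(4,1,3)] unfolding V_def by blast
  have V: "open V" unfolding V_def using open_mapping_thm3[OF B(4,1,3)] .
  have \<zeta>_mem: "\<zeta> v \<in> B" "\<zeta> v \<in> S" if "v \<in> V" for v
    using that \<zeta>(3) B(2) by (auto simp: V_def)
  have d\<zeta>: "deriv \<zeta> v = 1 / \<phi> (\<zeta> v)" if "v \<in> V" for v
  proof -
    from that obtain z where z: "z \<in> B" "v = \<Phi> z" by (auto simp: V_def)
    then have "deriv \<Phi> z = \<phi> z" using B(2) by (intro DERIV_imp_deriv \<Phi>_DERIV) auto
    with \<zeta>(2)[OF z(1)] have "\<phi> z * deriv \<zeta> v = 1" by (simp add: z)
    moreover from this have "\<phi> z \<noteq> 0" by auto
    ultimately show ?thesis using \<zeta>(3)[OF z(1)] by (simp add: z field_simps)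
  qed
  have \<phi>_nz: "\<phi> z \<noteq> 0" for z by (simp add: \<phi>_def)
  have \<zeta>_DERIV: "(\<zeta> has_field_derivative deriv \<zeta> v) (at v)" if "v \<in> V" for v
    using \<zeta>(1) V that by (intro holomorphic_derivI)
  \<comment> \<open>Differentiating \<zeta>' = 1 / \<phi>(\<zeta>) with \<phi>' = K \<phi> gives the
    first geodesic equation.\<close>
  have \<zeta>'_DERIV: "(deriv \<zeta> has_field_derivative - K (\<zeta> v) * (deriv \<zeta> v)\<^sup>2) (at v)" if "v \<in> V" for v
  proof (rule has_field_derivative_transform_within_open[OF _ V that])
    have "((\<lambda>v. \<phi> (\<zeta> v)) has_field_derivative K (\<zeta> v) * \<phi> (\<zeta> v) * deriv \<zeta> v) (at v)"
      using DERIV_chain2[OF \<phi>_DERIV[OF \<zeta>_mem(2)[OF that]] \<zeta>_DERIV[OF that]] .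
    then show "((\<lambda>v. 1 / \<phi> (\<zeta> v)) has_field_derivative - K (\<zeta> v) * (deriv \<zeta> v)\<^sup>2) (at v)"
      by (auto intro!: derivative_eq_intros simp: \<phi>_nz d\<zeta>[OF that] power2_eq_square)
  qed (simp add: d\<zeta>)
  have X\<zeta>_DERIV: "((\<lambda>v. X (\<zeta> v)) has_field_derivative deriv X (\<zeta> v) * deriv \<zeta> v) (at v)" if "v \<in> V" for v
    using DERIV_chain2[OF X_DERIV[OF \<zeta>_mem(2)[OF that]] \<zeta>_DERIV[OF that]] .
  have ddX\<zeta>: "deriv (deriv (\<lambda>v. X (\<zeta> v))) v
      = (deriv (deriv X) (\<zeta> v) - deriv X (\<zeta> v) * K (\<zeta> v)) * (deriv \<zeta> v)\<^sup>2" if "v \<in> V" for v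
  proof (rule DERIV_imp_deriv, rule has_field_derivative_transform_within_open[OF _ V that])
    have "((\<lambda>v. deriv X (\<zeta> v)) has_field_derivative deriv (deriv X) (\<zeta> v) * deriv \<zeta> v) (at v)"
      using DERIV_chain2[OF X'_DERIV[OF \<zeta>_mem(2)[OF that]] \<zeta>_DERIV[OF that]] .
    then show "((\<lambda>v. deriv X (\<zeta> v) * deriv \<zeta> v) has_field_derivative
        (deriv (deriv X) (\<zeta> v) - deriv X (\<zeta> v) * K (\<zeta> v)) * (deriv \<zeta> v)\<^sup>2) (at v)"
      by (auto intro!: derivative_eq_intros \<zeta>'_DERIV that simp: power2_eq_square algebra_simps)
  qed (simp add: DERIV_imp_deriv[OF X\<zeta>_DERIV])
  define c :: "complex \<Rightarrow> complex^2" where "c v = vector [\<zeta> v, X (\<zeta> v)]" for v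
  have c: "(\<lambda>v. c v $ 1) = \<zeta>" "(\<lambda>v. c v $ 2) = (\<lambda>v. X (\<zeta> v))" "c v $ 1 = \<zeta> v" "c v $ 2 = X (\<zeta> v)" for v
    by (simp_all add: c_def)
  have "complex_geodesic (Hmfd h U) (Gmetric h) V c"
    unfolding complex_geodesic_def forall_2 sum_2 c
  proof (intro conjI ballI)
    show "open V" "\<zeta> holomorphic_on V" by fact+
    show "(\<lambda>v. X (\<zeta> v)) holomorphic_on V" using X\<zeta>_DERIV V by (meson holomorphic_on_open)
    show "c ` V \<subseteq> Hmfd h U"
      using \<zeta>_mem(2) X_nz h_neq assms(4) by (fastforce simp: Hmfd_def c)
    fix v assume v: "v \<in> V"
    define z where "z = \<zeta> v"
    have z: "z \<in> S" using \<zeta>_mem(2)[OF v] by (simp add: z_def)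
    have 1: "h field_differentiable at (c v $ 1)"
      using h open_S z by (metis c(3) z_def holomorphic_on_imp_differentiable_at)
    have 2: "c v $ 2 \<noteq> 0" "h (c v $ 1) - (c v $ 2)\<^sup>2 \<noteq> 0"
      using X_nz[OF z] h_neq[OF z] by (simp_all add: c z_def)
    note \<Gamma> = christoffel_Gmetric[OF 1 2, unfolded c, folded z_def, folded w_def]
    note derivs = DERIV_imp_deriv[OF \<zeta>'_DERIV[OF v]] DERIV_imp_deriv[OF X\<zeta>_DERIV[OF v]] ddX\<zeta>[OF v]
    show "deriv (deriv \<zeta>) v +
      (christoffel (Gmetric h) 1 1 1 (c v) * deriv \<zeta> v * deriv \<zeta> v +
       christoffel (Gmetric h) 1 1 2 (c v) * deriv \<zeta> v * deriv (\<lambda>v. X (\<zeta> v)) v +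
       (christoffel (Gmetric h) 1 2 1 (c v) * deriv (\<lambda>v. X (\<zeta> v)) v * deriv \<zeta> v +
        christoffel (Gmetric h) 1 2 2 (c v) * deriv (\<lambda>v. X (\<zeta> v)) v * deriv (\<lambda>v. X (\<zeta> v)) v)) = 0"
      unfolding \<Gamma> derivs z_def[symmetric] K_def by (simp add: power2_eq_square algebra_simps)
    show "deriv (deriv (\<lambda>v. X (\<zeta> v))) v +
      (christoffel (Gmetric h) 2 1 1 (c v) * deriv \<zeta> v * deriv \<zeta> v +
       christoffel (Gmetric h) 2 1 2 (c v) * deriv \<zeta> v * deriv (\<lambda>v. X (\<zeta> v)) v +
       (christoffel (Gmetric h) 2 2 1 (c v) * deriv (\<lambda>v. X (\<zeta> v)) v * deriv \<zeta> v +
        christoffel (Gmetric h) 2 2 2 (c v) * deriv (\<lambda>v. X (\<zeta> v)) v * deriv (\<lambda>v. X (\<zeta> v)) v)) = 0"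
      (is "?L = 0")
    proof -
      have "?L = (deriv (deriv X) z - deriv X z * K z + (2 * X z * w z + (w z)\<^sup>2 / X z)
        - (deriv X z)\<^sup>2 / X z) * (deriv \<zeta> v)\<^sup>2"
        unfolding \<Gamma> derivs z_def[symmetric] by (simp add: power2_eq_square algebra_simps)
      then show ?thesis using geodesic_ode_K[OF assms(2) z] by simp
    qed
  qed
  moreover have "\<Phi> z0 = 0" "z0 \<in> B" using r by (auto simp: \<Phi>_def B_def)
  then have "0 \<in> V" "\<zeta> 0 = z0" using \<zeta>(3)[of z0] by (force simp: V_def)+
  moreover have "\<zeta> ` V = B" using \<zeta>(3) by (force simp: V_def)
  moreover have "deriv \<zeta> v \<noteq> 0" if "v \<in> V" for v using d\<zeta>[OF that] \<phi>_nz by simp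
  ultimately have "explicit_geodesic h U B z0 X"
    unfolding explicit_geodesic_def
    by (intro exI[of _ V] exI[of _ c] conjI ballI) (simp_all add: c)
  then show thesis using that r by (simp add: B_def)
qed

end

section \<open>Existence of a profile near every point\<close>

text \<open>The nonlinear equation is not solved directly: two logarithmic derivatives f1, f2 of
  linear solutions satisfy the Riccati equation, and \<open>X\<close> is a root of - f1 f2.\<close>

lemma nondegenerate_profile_exists:
  assumes "open U" "h holomorphic_on U" "z0 \<in> U"
  obtains r X where "r > 0" "ball z0 r \<subseteq> U" "nondegenerate_profile h X (ball z0 r)"
    "geodesic_ode h (ball z0 r) X" "discr h X z0 \<noteq> 0"
proof -
  \<comment> \<open>\<open>a\<close> and \<open>b\<close> become f1 and f2 at \<open>z0\<close>.
    Nonzero values give X \<noteq> 0, distinct ones a nonzero discriminant, and a b \<noteq> - h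
    gives X^2 \<noteq> h.\<close>
  obtain a b :: complex where ab: "a \<noteq> 0" "b \<noteq> 0" "a \<noteq> b" "a * b \<noteq> - h z0"
  proof -
    have inf: "infinite (UNIV - {0, 1, - h z0} :: complex set)"
      by (intro Diff_infinite_finite infinite_UNIV_char_0) auto
    obtain b where "b \<in> UNIV - {0, 1, - h z0}" using infinite_imp_nonempty[OF inf] by blast
    then show ?thesis using that[of 1 b] by simp
  qed
  obtain r1 u1 where u1: "r1 > 0" "ball z0 r1 \<subseteq> U" "ode_solution h (ball z0 r1) u1" "u1 z0 = 1" "deriv u1 z0 = a"
    using ode_solution_local[OF assms, where a = 1 and b = a] by blast
  obtain r2 u2 where u2: "r2 > 0" "ball z0 r2 \<subseteq> U" "ode_solution h (ball z0 r2) u2" "u2 z0 = 1" "deriv u2 z0 = b"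
    using ode_solution_local[OF assms, where a = 1 and b = b] by blast
  define R where "R = min r1 r2"
  define f1 where "f1 z = deriv u1 z / u1 z" for z
  define f2 where "f2 z = deriv u2 z / u2 z" for z
  \<comment> \<open>One product gathers everything that must stay nonzero, so a single continuity
    argument yields the ball.\<close>
  define G where
    "G z = u1 z * u2 z * (deriv u1 z * deriv u2 z * (deriv u1 z * deriv u2 z + h z * (u1 z * u2 z)))" for z
  have D1: "(u1 has_field_derivative deriv u1 z) (at z)" "(deriv u1 has_field_derivative - (h z * u1 z)) (at z)"
    and D2: "(u2 has_field_derivative deriv u2 z) (at z)" "(deriv u2 has_field_derivative - (h z * u2 z)) (at z)"
    if "z \<in> ball z0 R" for z
    using ode_solution_derivs[OF open_ball u1(3), of z] ode_solution_derivs[OF open_ball u2(3), of z] that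
    by (auto simp: R_def)
  have "R > 0" using u1 u2 by (simp add: R_def)
  then have z0: "z0 \<in> ball z0 R" by simp
  have cont: "continuous_on (ball z0 R) G" unfolding G_def
    by (intro continuous_intros continuous_at_imp_continuous_on ballI DERIV_isCont
        holomorphic_on_imp_continuous_on[OF holomorphic_on_subset[OF assms(2)]])
       (use D1 D2 u1(2) in \<open>auto simp: R_def\<close>)
  have "G z0 \<noteq> 0" using u1 u2 ab by (auto simp: G_def eq_neg_iff_add_eq_0)
  from continuous_on_avoid[OF cont z0 this]
  obtain e where e: "e > 0" "\<And>z. z \<in> ball z0 R \<Longrightarrow> dist z0 z < e \<Longrightarrow> G z \<noteq> 0" by blast
  define r where "r = min e R"
  define S where "S = ball z0 r"
  have S: "S \<subseteq> ball z0 R" "open S" "S \<subseteq> U" "z0 \<in> S" "simply_connected S"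
    using e \<open>R > 0\<close> u1(2) by (auto simp: S_def r_def R_def simply_connected_ball)
  have G: "G z \<noteq> 0" if "z \<in> S" for z using e(2)[of z] that by (auto simp: S_def r_def)
  have nz: "u1 z \<noteq> 0" "u2 z \<noteq> 0" "f1 z * f2 z \<noteq> 0" "f1 z * f2 z \<noteq> - h z" if "z \<in> S" for z
    using G[OF that] by (auto simp: G_def f1_def f2_def divide_simps eq_neg_iff_add_eq_0)
  have f1: "(f1 has_field_derivative - (f1 z)\<^sup>2 - h z) (at z)"
    and f2: "(f2 has_field_derivative - (f2 z)\<^sup>2 - h z) (at z)" if "z \<in> S" for z
    using D1[of z] D2[of z] S(1) nz[OF that] that unfolding f1_def[abs_def] f2_def[abs_def]
    by (auto intro!: derivative_eq_intros simp: power2_eq_square field_simps)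
  have f_holo: "f1 holomorphic_on S" "f2 holomorphic_on S"
    using f1 f2 S(2) by (meson holomorphic_on_open)+
  have f12: "(\<lambda>z. - (f1 z * f2 z)) holomorphic_on S" by (intro holomorphic_intros f_holo)
  \<comment> \<open>On a contractible set a holomorphic function without zeros has a holomorphic
    square root.\<close>
  have "contractible S" by (simp add: S_def convex_imp_contractible)
  then obtain X where X_holo: "X holomorphic_on S" and X_sq: "\<And>z. z \<in> S \<Longrightarrow> - (f1 z * f2 z) = (X z)\<^sup>2"
    using contractible_imp_holomorphic_sqrt[OF f12] nz(3) by (metis neg_equal_0_iff_equal)
  interpret nondegenerate_profile h X S
  proof
    show "open S" "h holomorphic_on S" "X holomorphic_on S"
      using S X_holo assms holomorphic_on_subset by auto
    show "X z \<noteq> 0" "h z \<noteq> (X z)\<^sup>2" if "z \<in> S" for z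
      using X_sq[OF that, symmetric] nz(3,4)[OF that] by auto
  qed
  \<comment> \<open>Differentiating X^2 = - f1 f2 and inserting both Riccati equations gives 2 X X'
    = (h + f1 f2)(f1 + f2), whose first factor is \<open>w\<close>.\<close>
  have p_eq: "p z = f1 z + f2 z" if z: "z \<in> S" for z
  proof -
    have "((\<lambda>z. - (f1 z * f2 z)) has_field_derivative 2 * X z * deriv X z) (at z)"
      by (rule has_field_derivative_transform_within_open[OF _ S(2) z, of "\<lambda>z. (X z)\<^sup>2"])
         (auto intro!: derivative_eq_intros X_DERIV z simp: X_sq)
    moreover have "((\<lambda>z. - (f1 z * f2 z)) has_field_derivative
        - ((- (f1 z)\<^sup>2 - h z) * f2 z + f1 z * (- (f2 z)\<^sup>2 - h z))) (at z)"
      by (auto intro!: derivative_eq_intros f1 f2 z)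
    ultimately have "2 * X z * deriv X z = - ((- (f1 z)\<^sup>2 - h z) * f2 z + f1 z * (- (f2 z)\<^sup>2 - h z))"
      by (rule DERIV_unique)
    also have "\<dots> = w z * (f1 z + f2 z)" using X_sq[OF z] unfolding w_def by algebra
    finally show ?thesis using w_nz[OF z] by (simp add: p_def)
  qed
  have "geodesic_ode h S X"
    unfolding geodesic_ode_iff
  proof
    fix z assume z: "z \<in> S"
    have "(p has_field_derivative (- (f1 z)\<^sup>2 - h z) + (- (f2 z)\<^sup>2 - h z)) (at z)"
      by (rule has_field_derivative_transform_within_open[OF DERIV_add[OF f1 f2] S(2) z])
         (use z p_eq in auto)
    then have "deriv p z = (- (f1 z)\<^sup>2 - h z) + (- (f2 z)\<^sup>2 - h z)" by (rule DERIV_imp_deriv)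
    \<comment> \<open>Here p^2 + 2 X^2 = f1^2 + f2^2, so the sum of the two Riccati equations is the
      claim.\<close>
    then show "deriv p z + (p z)\<^sup>2 + 2 * (X z)\<^sup>2 + 2 * h z = 0"
      using X_sq[OF z] p_eq[OF z] by algebra
  qed
  moreover have "discr h X z0 \<noteq> 0"
  proof -
    have "(p z0)\<^sup>2 + 4 * (X z0)\<^sup>2 = (f1 z0 - f2 z0)\<^sup>2"
      using X_sq[OF S(4)] p_eq[OF S(4)] by algebra
    moreover have "f1 z0 \<noteq> f2 z0" using u1 u2 ab by (simp add: f1_def f2_def)
    ultimately show ?thesis using discr_eq[OF S(4)] w_nz[OF S(4)] X_nz[OF S(4)] by simp
  qed
  ultimately show thesis
    using that[of r X] S e \<open>R > 0\<close> nondegenerate_profile_axioms by (auto simp: S_def r_def)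
qed

theorem theorem7:
  fixes h :: "complex \<Rightarrow> complex" and U :: "complex set"
  assumes "open U" and "h holomorphic_on U"
  shows
    "(\<forall>z0\<in>U. \<exists>U0 X s.
        open U0 \<and> simply_connected U0 \<and> z0 \<in> U0 \<and> U0 \<subseteq> U \<and>
        X holomorphic_on U0 \<and> (\<forall>z\<in>U0. X z \<noteq> 0) \<and> (\<forall>z\<in>U0. h z \<noteq> (X z)\<^sup>2) \<and>
        (\<exists>z\<in>U0. discr h X z \<noteq> 0) \<and>
        explicit_geodesic h U U0 z0 X \<and>
        sqrt_branch U0 (discr h X) s \<and>
        (\<forall>\<gamma>. (\<forall>z\<in>U0. holomorphic_curve U0 z0 z (\<gamma> z)) \<longrightarrow>
           general_solution h U0 (\<lambda>z. u_top h X s (\<gamma> z)) (\<lambda>z. u_bot h X s (\<gamma> z))))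
     \<and>
     (\<forall>U0 z0 X.
        open U0 \<and> simply_connected U0 \<and> z0 \<in> U0 \<and> U0 \<subseteq> U \<and>
        X holomorphic_on U0 \<and> (\<forall>z\<in>U0. X z \<noteq> 0) \<and> (\<forall>z\<in>U0. h z \<noteq> (X z)\<^sup>2) \<and>
        (\<exists>z\<in>U0. discr h X z \<noteq> 0) \<longrightarrow>
        (geodesic_ode h U0 X \<longrightarrow> (\<exists>s. sqrt_branch U0 (discr h X) s)) \<and>
        (\<forall>s. sqrt_branch U0 (discr h X) s \<longrightarrow>
           (\<forall>\<gamma>. (\<forall>z\<in>U0. holomorphic_curve U0 z0 z (\<gamma> z)) \<longrightarrow>
              (general_solution h U0 (\<lambda>z. u_top h X s (\<gamma> z)) (\<lambda>z. u_bot h X s (\<gamma> z))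
                 \<longleftrightarrow> geodesic_ode h U0 X)) \<and>
           (\<forall>z\<in>U0. \<forall>\<gamma>1 \<gamma>2. holomorphic_curve U0 z0 z \<gamma>1 \<and> holomorphic_curve U0 z0 z \<gamma>2 \<longrightarrow>
              u_top h X s \<gamma>1 = u_top h X s \<gamma>2 \<and> u_bot h X s \<gamma>1 = u_bot h X s \<gamma>2)))"
proof (rule conjI)
  show "\<forall>U0 z0 X.
      open U0 \<and> simply_connected U0 \<and> z0 \<in> U0 \<and> U0 \<subseteq> U \<and>
      X holomorphic_on U0 \<and> (\<forall>z\<in>U0. X z \<noteq> 0) \<and> (\<forall>z\<in>U0. h z \<noteq> (X z)\<^sup>2) \<and>
      (\<exists>z\<in>U0. discr h X z \<noteq> 0) \<longrightarrow>
      (geodesic_ode h U0 X \<longrightarrow> (\<exists>s. sqrt_branch U0 (discr h X) s)) \<and>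
      (\<forall>s. sqrt_branch U0 (discr h X) s \<longrightarrow>
         (\<forall>\<gamma>. (\<forall>z\<in>U0. holomorphic_curve U0 z0 z (\<gamma> z)) \<longrightarrow>
            (general_solution h U0 (\<lambda>z. u_top h X s (\<gamma> z)) (\<lambda>z. u_bot h X s (\<gamma> z))
               \<longleftrightarrow> geodesic_ode h U0 X)) \<and>
         (\<forall>z\<in>U0. \<forall>\<gamma>1 \<gamma>2. holomorphic_curve U0 z0 z \<gamma>1 \<and> holomorphic_curve U0 z0 z \<gamma>2 \<longrightarrow>
            u_top h X s \<gamma>1 = u_top h X s \<gamma>2 \<and> u_bot h X s \<gamma>1 = u_bot h X s \<gamma>2))"
  proof (intro allI impI, elim conjE)
    fix U0 z0 X
    assume U0: "open U0" "simply_connected U0" "z0 \<in> U0" "U0 \<subseteq> U" "X holomorphic_on U0"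
      "\<forall>z\<in>U0. X z \<noteq> 0" "\<forall>z\<in>U0. h z \<noteq> (X z)\<^sup>2" and D: "\<exists>z\<in>U0. discr h X z \<noteq> 0"
    interpret nondegenerate_profile h X U0
      using U0 holomorphic_on_subset[OF assms(2)] by unfold_locales auto
    show "(geodesic_ode h U0 X \<longrightarrow> (\<exists>s. sqrt_branch U0 (discr h X) s)) \<and>
      (\<forall>s. sqrt_branch U0 (discr h X) s \<longrightarrow>
         (\<forall>\<gamma>. (\<forall>z\<in>U0. holomorphic_curve U0 z0 z (\<gamma> z)) \<longrightarrow>
            (general_solution h U0 (\<lambda>z. u_top h X s (\<gamma> z)) (\<lambda>z. u_bot h X s (\<gamma> z))
               \<longleftrightarrow> geodesic_ode h U0 X)) \<and>
         (\<forall>z\<in>U0. \<forall>\<gamma>1 \<gamma>2. holomorphic_curve U0 z0 z \<gamma>1 \<and> holomorphic_curve U0 z0 z \<gamma>2 \<longrightarrow>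
            u_top h X s \<gamma>1 = u_top h X s \<gamma>2 \<and> u_bot h X s \<gamma>1 = u_bot h X s \<gamma>2))"
    proof (intro conjI allI impI ballI)
      assume "geodesic_ode h U0 X"
      then show "\<exists>s. sqrt_branch U0 (discr h X) s"
        using sqrt_branch_if_geodesic_ode(1)[OF U0(2)] D by blast
    next
      fix s \<gamma> assume "sqrt_branch U0 (discr h X) s" "\<forall>z\<in>U0. holomorphic_curve U0 z0 z (\<gamma> z)"
      then show "general_solution h U0 (\<lambda>z. u_top h X s (\<gamma> z)) (\<lambda>z. u_bot h X s (\<gamma> z))
          \<longleftrightarrow> geodesic_ode h U0 X"
        by (intro general_solution_iff_geodesic_ode[OF U0(2,3) D]) auto
    next
      fix s z \<gamma>1 \<gamma>2
      assume "sqrt_branch U0 (discr h X) s"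
        and \<gamma>: "holomorphic_curve U0 z0 z \<gamma>1 \<and> holomorphic_curve U0 z0 z \<gamma>2"
      note * = u_curve_independent[OF U0(2,3) D this(1) conjunct1[OF \<gamma>] conjunct2[OF \<gamma>]]
      show "u_top h X s \<gamma>1 = u_top h X s \<gamma>2" "u_bot h X s \<gamma>1 = u_bot h X s \<gamma>2"
        using * by simp_all
    qed
  qed
next
  show "\<forall>z0\<in>U. \<exists>U0 X s.
      open U0 \<and> simply_connected U0 \<and> z0 \<in> U0 \<and> U0 \<subseteq> U \<and>
      X holomorphic_on U0 \<and> (\<forall>z\<in>U0. X z \<noteq> 0) \<and> (\<forall>z\<in>U0. h z \<noteq> (X z)\<^sup>2) \<and>
      (\<exists>z\<in>U0. discr h X z \<noteq> 0) \<and>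
      explicit_geodesic h U U0 z0 X \<and>
      sqrt_branch U0 (discr h X) s \<and>
      (\<forall>\<gamma>. (\<forall>z\<in>U0. holomorphic_curve U0 z0 z (\<gamma> z)) \<longrightarrow>
         general_solution h U0 (\<lambda>z. u_top h X s (\<gamma> z)) (\<lambda>z. u_bot h X s (\<gamma> z)))"
  proof
    fix z0 assume "z0 \<in> U"
    then obtain R X where R: "R > 0" "ball z0 R \<subseteq> U" and profile: "nondegenerate_profile h X (ball z0 R)"
      and ode: "geodesic_ode h (ball z0 R) X" and D: "discr h X z0 \<noteq> 0"
      using nondegenerate_profile_exists[OF assms] by blast
    \<comment> \<open>The ball shrinks until the affine parameter is invertible. The conditions on
      \<open>X\<close> and the geodesic equation restrict to it, and the discriminant is nonzero at
      its centre.\<close>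
    obtain r where r: "r > 0" "ball z0 r \<subseteq> ball z0 R" and geo: "explicit_geodesic h U (ball z0 r) z0 X"
      using nondegenerate_profile.explicit_geodesic_local[OF profile simply_connected_ball ode _ R(2), of z0] R(1)
      by (metis centre_in_ball)
    define U0 where "U0 = ball z0 r"
    have U0: "open U0" "simply_connected U0" "z0 \<in> U0" "U0 \<subseteq> U" "\<exists>z\<in>U0. discr h X z \<noteq> 0"
      using r R D by (auto simp: U0_def simply_connected_ball)
    interpret nondegenerate_profile h X U0
      using profile r(2) unfolding nondegenerate_profile_def U0_def
      by (auto intro: holomorphic_on_subset)
    have ode0: "geodesic_ode h U0 X" using ode r(2) by (auto simp: geodesic_ode_def U0_def)
    obtain s where s: "sqrt_branch U0 (discr h X) s"
      using sqrt_branch_if_geodesic_ode(1)[OF U0(2) ode0 U0(3) D] by blast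
    have "general_solution h U0 (\<lambda>z. u_top h X s (\<gamma> z)) (\<lambda>z. u_bot h X s (\<gamma> z))"
      if "\<forall>z\<in>U0. holomorphic_curve U0 z0 z (\<gamma> z)" for \<gamma>
      using general_solution_iff_geodesic_ode[OF U0(2,3,5) s, of \<gamma>] that ode0 by blast
    then show "\<exists>U0 X s.
        open U0 \<and> simply_connected U0 \<and> z0 \<in> U0 \<and> U0 \<subseteq> U \<and>
        X holomorphic_on U0 \<and> (\<forall>z\<in>U0. X z \<noteq> 0) \<and> (\<forall>z\<in>U0. h z \<noteq> (X z)\<^sup>2) \<and>
        (\<exists>z\<in>U0. discr h X z \<noteq> 0) \<and>
        explicit_geodesic h U U0 z0 X \<and>
        sqrt_branch U0 (discr h X) s \<and>
        (\<forall>\<gamma>. (\<forall>z\<in>U0. holomorphic_curve U0 z0 z (\<gamma> z)) \<longrightarrow>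
           general_solution h U0 (\<lambda>z. u_top h X s (\<gamma> z)) (\<lambda>z. u_bot h X s (\<gamma> z)))"
      using U0 X X_nz h_neq geo[folded U0_def] s by blast
  qed
qed

end
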